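(* The following convergence of random analytic functions (of the variable $\beta$) holds weakly on $\mathcal{H}(E_1)$ as $n\to\infty$: $$\frac{\mathcal{Z}_n(\beta)}{\mathbb{E}\mathcal{Z}_n(\beta)}\longrightarrow1.$$
   Context: GREM. Fix $d\in\mathbb{N}$, variances $a_1,\dots,a_d>0$, branching exponents $\alpha_1,\dots,\alpha_d>1$, and sequences of natural numbers $N_{n,1},\dots,N_{n,d}$ with $\lim_{n\to\infty}N_{n,j}/\alpha_j^n=1$ for each $j$. Let $\mathbb{S}_n=\{\varepsilon=(\varepsilon_1,\dots,\varepsilon_d)\in\mathbb{N}^d:1\le\varepsilon_j\le N_{n,j},\ 1\le j\le d\}$. Let $\{\xi_{\varepsilon_1\dots\varepsilon_j}:1\le j\le d,\ 1\le\varepsilon_i\le N_{n,i}\}$ be independent real standard normal random variables, $X_\varepsilon=\sum_{j=1}^d\sqrt{a_j}\,\xi_{\varepsilon_1\dots\varepsilon_j}$, and $\mathcal{Z}_n(\beta)=\sum_{\varepsilon\in\mathbb{S}_n}e^{\beta\sqrt n X_\varepsilon}$, $\beta=\sigma+i\tau\in\mathbb{C}$. Put $\sigma_j=\sqrt{2\log\alpha_j/a_j}$; it is assumed throughout that $\sigma_1<\dots<\sigma_d$. $E_1=\mathbb{C}\setminus\overline{G_1\cup F_1}$, where $G_1=\{\beta:2|\sigma|>\sigma_1,\ |\sigma|+|\tau|>\sigma_1\}$ and $F_1=\{\beta:2|\sigma|<\sigma_1,\ 2(\sigma^2+\tau^2)>\sigma_1^2\}$. For open $D\subset\mathbb{C}$,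 $\mathcal{H}(D)$ is the space of analytic functions on $D$ with the topology of locally uniform convergence; weak convergence on $\mathcal{H}(D)$ means convergence in distribution of random elements of $\mathcal{H}(D)$. *)

theory Defs
  imports "HOL-Complex_Analysis.Complex_Analysis" "HOL-Probability.Probability"
begin

section \<open>The space of analytic functions on an open set\<close>

text \<open>
  Elements of the space of analytic functions on \<open>D\<close> are represented as functions on the whole
  plane with the value \<open>undefined\<close> outside \<open>D\<close>, so that each analytic function on \<open>D\<close> has
  exactly one representative.
\<close>

definition analytic_fun :: "complex set \<Rightarrow> (complex \<Rightarrow> complex) set" where
  "analytic_fun D = {f. f holomorphic_on D} \<inter> extensional D"

text \<open>
  The topology of locally uniform convergence. As \<open>D\<close> is open, hence locally compact, this is
  uniform convergence on the compact subsets of \<open>D\<close>; see lemma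
  \<open>limitin_analytic_topology\<close> below.
\<close>

definition analytic_open :: "complex set \<Rightarrow> (complex \<Rightarrow> complex) set \<Rightarrow> bool" where
  "analytic_open D U \<longleftrightarrow> U \<subseteq> analytic_fun D \<and>
     (\<forall>f\<in>U. \<exists>K e. compact K \<and> K \<subseteq> D \<and> 0 < (e::real) \<and>
        (\<forall>g\<in>analytic_fun D. (\<forall>z\<in>K. dist (g z) (f z) < e) \<longrightarrow> g \<in> U))"

definition analytic_topology :: "complex set \<Rightarrow> (complex \<Rightarrow> complex) topology" where
  "analytic_topology D = topology (analytic_open D)"

lemma istopology_analytic_open: "istopology (analytic_open D)"
  unfolding istopology_def
proof (intro conjI allI impI)
  fix S T assume S: "analytic_open D S" and T: "analytic_open D T"
  show "analytic_open D (S \<inter> T)"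
    unfolding analytic_open_def
  proof (intro conjI ballI)
    show "S \<inter> T \<subseteq> analytic_fun D" using S by (auto simp: analytic_open_def)
    fix f assume f: "f \<in> S \<inter> T"
    from S f obtain K e where K: "compact K" "K \<subseteq> D" "0 < (e::real)"
      "\<forall>g\<in>analytic_fun D. (\<forall>z\<in>K. dist (g z) (f z) < e) \<longrightarrow> g \<in> S"
      unfolding analytic_open_def by blast
    from T f obtain L r where L: "compact L" "L \<subseteq> D" "0 < (r::real)"
      "\<forall>g\<in>analytic_fun D. (\<forall>z\<in>L. dist (g z) (f z) < r) \<longrightarrow> g \<in> T"
      unfolding analytic_open_def by blast
    show "\<exists>K e. compact K \<and> K \<subseteq> D \<and> 0 < (e::real) \<and>
        (\<forall>g\<in>analytic_fun D. (\<forall>z\<in>K. dist (g z) (f z) < e) \<longrightarrow> g \<in> S \<inter> T)"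
      using K L by (intro exI[of _ "K \<union> L"] exI[of _ "min e r"]) (auto intro: compact_Un)
  qed
next
  fix \<K> assume "\<forall>S\<in>\<K>. analytic_open D S"
  then show "analytic_open D (\<Union>\<K>)"
    unfolding analytic_open_def by (simp add: Union_iff) (meson Sup_least)
qed

lemma openin_analytic_topology: "openin (analytic_topology D) U \<longleftrightarrow> analytic_open D U"
  by (simp add: analytic_topology_def istopology_analytic_open topology_inverse')

lemma topspace_analytic_topology: "topspace (analytic_topology D) = analytic_fun D"
proof
  show "topspace (analytic_topology D) \<subseteq> analytic_fun D"
    by (auto simp: topspace_def openin_analytic_topology analytic_open_def)
  have "analytic_open D (analytic_fun D)"
    by (auto simp: analytic_open_def intro!: exI[of _ "{}"] exI[of _ "1::real"])
  then show "analytic_fun D \<subseteq> topspace (analytic_topology D)"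
    by (simp add: openin_analytic_topology openin_subset)
qed

lemma limitin_analytic_topology:
  "limitin (analytic_topology D) f l F \<longleftrightarrow>
     l \<in> analytic_fun D \<and> (\<forall>\<^sub>F n in F. f n \<in> analytic_fun D) \<and>
     (\<forall>K. compact K \<and> K \<subseteq> D \<longrightarrow> uniform_limit K f l F)"
    (is "?L \<longleftrightarrow> ?R")
proof
  assume L: ?L
  have l: "l \<in> analytic_fun D"
    using L by (simp add: limitin_def topspace_analytic_topology)
  have ev: "\<forall>\<^sub>F n in F. f n \<in> U" if "analytic_open D U" "l \<in> U" for U
    using L that by (simp add: limitin_def openin_analytic_topology)
  have "\<forall>\<^sub>F n in F. f n \<in> analytic_fun D"
    using ev[of "analytic_fun D"] l openin_topspace[of "analytic_topology D"]
    by (simp add: openin_analytic_topology topspace_analytic_topology)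
  moreover have "uniform_limit K f l F" if K: "compact K" "K \<subseteq> D" for K
    unfolding uniform_limit_iff
  proof (intro allI impI)
    fix e :: real assume e: "e > 0"
    define U where "U = {g \<in> analytic_fun D. \<exists>\<delta>>0. \<forall>z\<in>K. dist (g z) (l z) < e - \<delta>}"
    have "analytic_open D U"
      unfolding analytic_open_def
    proof (intro conjI ballI)
      show "U \<subseteq> analytic_fun D" by (auto simp: U_def)
      fix g assume "g \<in> U"
      then obtain \<delta> where \<delta>: "\<delta> > 0" "\<forall>z\<in>K. dist (g z) (l z) < e - \<delta>"
        by (auto simp: U_def)
      have "h \<in> U" if h: "h \<in> analytic_fun D" "\<forall>z\<in>K. dist (h z) (g z) < \<delta> / 2" for h
      proof -
        have "dist (h z) (l z) < e - \<delta> / 2" if "z \<in> K" for z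
          using dist_triangle[of "h z" "l z" "g z"] h(2)[rule_format, OF that]
            \<delta>(2)[rule_format, OF that] by linarith
        then show ?thesis
          using h(1) \<delta>(1) by (auto simp: U_def intro!: exI[of _ "\<delta> / 2"])
      qed
      then show "\<exists>K e. compact K \<and> K \<subseteq> D \<and> 0 < (e::real) \<and>
          (\<forall>h\<in>analytic_fun D. (\<forall>z\<in>K. dist (h z) (g z) < e) \<longrightarrow> h \<in> U)"
        using K \<delta>(1) by (intro exI[of _ K] exI[of _ "\<delta> / 2"]) auto
    qed
    moreover have "l \<in> U"
      using l e by (auto simp: U_def intro!: exI[of _ "e / 2"])
    ultimately have "\<forall>\<^sub>F n in F. f n \<in> U" by (rule ev)
    then show "\<forall>\<^sub>F n in F. \<forall>z\<in>K. dist (f n z) (l z) < e"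
      by eventually_elim (fastforce simp: U_def)
  qed
  ultimately show ?R using l by blast
next
  assume R: ?R
  show ?L
    unfolding limitin_def
  proof (intro conjI allI impI)
    show "l \<in> topspace (analytic_topology D)"
      using R by (simp add: topspace_analytic_topology)
    fix U assume "openin (analytic_topology D) U \<and> l \<in> U"
    then obtain K e where K: "compact K" "K \<subseteq> D" "0 < (e::real)"
      "\<forall>g\<in>analytic_fun D. (\<forall>z\<in>K. dist (g z) (l z) < e) \<longrightarrow> g \<in> U"
      unfolding openin_analytic_topology analytic_open_def by blast
    have "\<forall>\<^sub>F n in F. \<forall>z\<in>K. dist (f n z) (l z) < e"
      using R K unfolding uniform_limit_iff by blast
    moreover have "\<forall>\<^sub>F n in F. f n \<in> analytic_fun D" using R by blast
    ultimately show "\<forall>\<^sub>F n in F. f n \<in> U"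
      by eventually_elim (use K in blast)
  qed
qed


section \<open>Convergence in distribution of random elements of a topological space\<close>

definition borel_of_topology :: "'x topology \<Rightarrow> 'x measure" where
  "borel_of_topology T = sigma (topspace T) {U. openin T U}"

text \<open>
  The random elements \<open>X n\<close> and \<open>Y\<close> may be defined on different probability spaces. That they are
  random elements of \<open>T\<close>, i.e. measurable for the Borel sets of \<open>T\<close>, is part of the notion.
\<close>

definition converges_in_distribution ::
  "'x topology \<Rightarrow> (nat \<Rightarrow> 'a measure) \<Rightarrow> (nat \<Rightarrow> 'a \<Rightarrow> 'x) \<Rightarrow> 'b measure \<Rightarrow> ('b \<Rightarrow> 'x) \<Rightarrow> bool" where
  "converges_in_distribution T M X P Y \<longleftrightarrow>
     (\<forall>n. X n \<in> M n \<rightarrow>\<^sub>M borel_of_topology T) \<and> Y \<in> P \<rightarrow>\<^sub>M borel_of_topology T \<and>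
     (\<forall>\<phi>. continuous_map T euclideanreal \<phi> \<and> bounded (\<phi> ` topspace T) \<longrightarrow>
        (\<lambda>n. \<integral>\<omega>. \<phi> (X n \<omega>) \<partial>M n) \<longlonglongrightarrow> (\<integral>\<omega>. \<phi> (Y \<omega>) \<partial>P))"


section \<open>The generalized random energy model\<close>

text \<open>
  Levels are numbered \<open>1, \<dots>, d\<close>. A multi-index with components \<open>1, \<dots>, j\<close> is a list of length
  \<open>j\<close>; list positions start at \<open>0\<close>, hence the shift. \<open>N n j\<close> is the number of children at level
  \<open>j\<close>.
\<close>

definition grem_level :: "(nat \<Rightarrow> nat \<Rightarrow> nat) \<Rightarrow> nat \<Rightarrow> nat \<Rightarrow> nat list set" where
  "grem_level N n j = {\<epsilon>. length \<epsilon> = j \<and> (\<forall>i\<in>{1..j}. 1 \<le> \<epsilon> ! (i - 1) \<and> \<epsilon> ! (i - 1) \<le> N n i)}"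

definition grem_nodes :: "nat \<Rightarrow> (nat \<Rightarrow> nat \<Rightarrow> nat) \<Rightarrow> nat \<Rightarrow> nat list set" where
  "grem_nodes d N n = (\<Union>j\<in>{1..d}. grem_level N n j)"

definition grem_energy ::
  "nat \<Rightarrow> (nat \<Rightarrow> real) \<Rightarrow> (nat list \<Rightarrow> 'a \<Rightarrow> real) \<Rightarrow> nat list \<Rightarrow> 'a \<Rightarrow> real" where
  "grem_energy d a \<xi> \<epsilon> \<omega> = (\<Sum>j=1..d. sqrt (a j) * \<xi> (take j \<epsilon>) \<omega>)"

definition grem_partition ::
  "nat \<Rightarrow> (nat \<Rightarrow> real) \<Rightarrow> (nat \<Rightarrow> nat \<Rightarrow> nat) \<Rightarrow> nat \<Rightarrow> (nat list \<Rightarrow> 'a \<Rightarrow> real) \<Rightarrow>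
     complex \<Rightarrow> 'a \<Rightarrow> complex" where
  "grem_partition d a N n \<xi> \<beta> \<omega> =
     (\<Sum>\<epsilon>\<in>grem_level N n d. exp (\<beta> * of_real (sqrt (real n) * grem_energy d a \<xi> \<epsilon> \<omega>)))"

definition grem_sigma :: "(nat \<Rightarrow> real) \<Rightarrow> (nat \<Rightarrow> real) \<Rightarrow> nat \<Rightarrow> real" where
  "grem_sigma a \<alpha> j = sqrt (2 * ln (\<alpha> j) / a j)"

text \<open>In the following three sets, \<open>s\<close> is the critical value \<open>\<sigma>\<^sub>j\<close> of the level considered.\<close>

definition grem_G :: "real \<Rightarrow> complex set" where
  "grem_G s = {\<beta>. 2 * \<bar>Re \<beta>\<bar> > s \<and> \<bar>Re \<beta>\<bar> + \<bar>Im \<beta>\<bar> > s}"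

definition grem_F :: "real \<Rightarrow> complex set" where
  "grem_F s = {\<beta>. 2 * \<bar>Re \<beta>\<bar> < s \<and> 2 * ((Re \<beta>)\<^sup>2 + (Im \<beta>)\<^sup>2) > s\<^sup>2}"

definition grem_E :: "real \<Rightarrow> complex set" where
  "grem_E s = UNIV - closure (grem_G s \<union> grem_F s)"

end

theory Submission
  imports Defs
begin

text \<open>
  The normalised partition function of the first \<open>j\<close> levels is a mean-one martingale in \<open>j\<close>, and
  revealing the variables node by node makes its increments conditionally centered. Hence for
  \<open>1 < p \<le> 2\<close> a von Bahr--Esseen type inequality bounds the \<open>p\<close>-th moment of its distance to \<open>1\<close>
  by a constant times \<open>\<Sum>\<^sub>m \<Prod>\<^sub>i\<^sub>\<le>\<^sub>m N\<^sub>i\<^bsup>1-p\<^esup> E\<bar>\<psi>\<^sub>i\<bar>\<^bsup>p\<^esup>\<close>, where \<open>\<psi>\<^sub>i\<close> is the normalised weight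
  \<open>exp(\<beta> b\<^sub>i \<xi> - \<beta>\<^sup>2 b\<^sub>i\<^sup>2 / 2)\<close> of an edge, \<open>b\<^sub>i\<^sup>2 = n a\<^sub>i\<close>. The \<open>i\<close>-th factor decays exponentially when
  \<open>p \<sigma>\<^sup>2 + p / (p - 1) \<tau>\<^sup>2 < \<sigma>\<^sub>i\<^sup>2\<close>. The minimum of the left-hand side over \<open>p > 1\<close> is
  \<open>(\<bar>\<sigma>\<bar> + \<bar>\<tau>\<bar>)\<^sup>2\<close>, attained at \<open>p = 1 + \<bar>\<tau>\<bar> / \<bar>\<sigma>\<bar>\<close>, and for \<open>p = 2\<close> it is \<open>2 (\<sigma>\<^sup>2 + \<tau>\<^sup>2)\<close>;
  so the region \<open>E\<^sub>1\<close> consists of points where some \<open>p\<close> works for \<open>i = 1\<close>, hence for all levels. As \<open>p\<close>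
  can be kept fixed on a small disc, Cauchy's formula turns the moment bounds into locally
  uniform convergence in probability, which for a constant limit is convergence in distribution.
\<close>

section \<open>Moments of sums and Gaussian exponentials\<close>

text \<open>Bernoulli's inequality for exponents in [0,1]: it is the weighted AM-GM inequality for
  the numbers 1 and \<open>1 + t\<close> with weights \<open>1 - q\<close> and
  \<open>q\<close>.\<close>

lemma powr_one_add_le:
  fixes t q :: real
  assumes "-1 \<le> t" "0 \<le> q" "q \<le> 1"
  shows "(1 + t) powr q \<le> 1 + q * t"
proof (cases "t = -1")
  case True then show ?thesis using assms by simp
next
  case False
  have "1 powr (1 - q) * (1 + t) powr q \<le> (1 - q) * 1 + q * (1 + t)"
    using assms False by (intro Youngs_inequality_0) auto
  then show ?thesis by (simp add: algebra_simps)
qed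

text \<open>A first-order expansion of \<open>norm z powr p\<close> whose remainder is of order
  \<open>norm w powr p\<close>. The middle term is real-linear in \<open>w\<close>, so it disappears
  in the mean when \<open>w\<close> is conditionally centered; for \<open>p < 2\<close> this
  replaces orthogonality of increments. If \<open>norm w < norm z\<close>, Bernoulli's inequality is
  applied to the squared norm with exponent \<open>p / 2\<close>, and the quadratic remainder is at
  most \<open>norm w powr p\<close> because \<open>p - 2 \<le> 0\<close>.\<close>

lemma norm_add_powr_le:
  fixes z w :: complex and p :: real
  assumes p: "1 < p" "p \<le> 2"
  shows "norm (z + w) powr p
    \<le> norm z powr p + p * Re (cnj z * norm z powr (p - 2) * w) + 6 * norm w powr p"
proof (cases "norm w < norm z")
  case True
  then have z: "norm z > 0" by (smt (verit) norm_ge_zero)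
  define t where "t = (2 * Re (cnj z * w) + (norm w)\<^sup>2) / (norm z)\<^sup>2"
  have sq: "(norm (z + w))\<^sup>2 = (norm z)\<^sup>2 * (1 + t)"
  proof -
    have "(norm (z + w))\<^sup>2 = (norm z)\<^sup>2 + 2 * Re (cnj z * w) + (norm w)\<^sup>2"
      unfolding cmod_power2 by (simp add: power2_eq_square algebra_simps)
    then show ?thesis using z unfolding t_def by (simp add: field_simps)
  qed
  have t: "1 + t \<ge> 0" using sq z by (metis zero_le_mult_iff zero_le_power2 not_less zero_less_power)
  have "norm (z + w) powr p = ((norm (z + w))\<^sup>2) powr (p / 2)"
    by (simp add: powr_half_sqrt[symmetric] powr_powr flip: powr_numeral)
  also have "\<dots> = norm z powr p * (1 + t) powr (p / 2)"
    unfolding sq using z t by (simp add: powr_mult powr_powr flip: powr_numeral)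
  also have "\<dots> \<le> norm z powr p * (1 + (p / 2) * t)"
    using t p by (intro mult_left_mono powr_one_add_le) auto
  also have "\<dots> = norm z powr p + p * (norm z powr (p - 2) * Re (cnj z * w))
      + p / 2 * (norm z powr (p - 2) * (norm w)\<^sup>2)"
  proof -
    have "norm z powr p = norm z powr (p - 2) * (norm z)\<^sup>2"
      using z by (simp add: powr_diff)
    then have "norm z powr p * ((p / 2) * t)
      = norm z powr (p - 2) * ((p / 2) * (2 * Re (cnj z * w) + (norm w)\<^sup>2))"
      using z unfolding t_def by simp
    then show ?thesis by (simp add: algebra_simps)
  qed
  also have "norm z powr (p - 2) * (norm w)\<^sup>2 \<le> norm w powr p"
  proof (cases "w = 0")
    case False
    have "norm z powr (p - 2) \<le> norm w powr (p - 2)"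
      using False True p by (intro powr_mono2') auto
    then have "norm z powr (p - 2) * (norm w)\<^sup>2 \<le> norm w powr (p - 2) * (norm w)\<^sup>2"
      by (intro mult_right_mono) auto
    also have "\<dots> = norm w powr p" using False by (simp add: powr_diff)
    finally show ?thesis .
  qed simp
  also have "Re (cnj z * norm z powr (p - 2) * w) = norm z powr (p - 2) * Re (cnj z * w)"
    by (simp add: algebra_simps)
  then have "norm z powr p + p * (norm z powr (p - 2) * Re (cnj z * w)) + p / 2 * norm w powr p
    \<le> norm z powr p + p * Re (cnj z * norm z powr (p - 2) * w) + 6 * norm w powr p"
    using p mult_right_mono[of "p/2" 6 "norm w powr p"] by simp
  finally show ?thesis using p by (simp add: mult_left_mono)
next
  case False
  \<comment> \<open>For \<open>norm z \<le> norm w\<close> each term is compared with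
    \<open>norm w powr p\<close> separately: the left-hand side costs 4, the linear term at most
    \<open>p \<le> 2\<close>, which gives the 6.\<close>
  have "norm (z + w) powr p \<le> (2 * norm w) powr p"
    using False p by (intro powr_mono2) (auto intro: order_trans[OF norm_triangle_ineq])
  also have "\<dots> = 2 powr p * norm w powr p" by (simp add: powr_mult)
  also have "\<dots> \<le> 2 powr 2 * norm w powr p"
    using p by (intro mult_right_mono powr_mono) auto
  finally have 1: "norm (z + w) powr p \<le> 4 * norm w powr p" by simp
  have "- Re (cnj z * norm z powr (p - 2) * w) \<le> norm (cnj z * norm z powr (p - 2) * w)"
    using complex_Re_le_cmod[of "- (cnj z * norm z powr (p - 2) * w)"] by simp
  also have "\<dots> = (norm z * norm z powr (p - 2)) * norm w"
    by (simp add: norm_mult)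
  also have "norm z * norm z powr (p - 2) = norm z powr (p - 1)"
    using powr_mult_base[of "norm z" "p - 2"] by simp
  also have "norm z powr (p - 1) * norm w \<le> norm w powr (p - 1) * norm w"
    using False p by (intro mult_right_mono powr_mono2) auto
  also have "\<dots> = norm w powr p"
    using powr_mult_base[of "norm w" "p - 1"] by (simp add: mult.commute)
  finally have 2: "- Re (cnj z * norm z powr (p - 2) * w) \<le> norm w powr p" .
  have "p * (- Re (cnj z * norm z powr (p - 2) * w)) \<le> p * norm w powr p"
    using 2 p by (intro mult_left_mono) auto
  also have "\<dots> \<le> 2 * norm w powr p" using p by (intro mult_right_mono) auto
  finally show ?thesis using 1 by (smt (verit) powr_ge_zero mult_minus_right)
qed

lemma norm_add_powr_le_sum:
  fixes z w :: "'a::real_normed_vector" and p :: real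
  assumes p: "0 \<le> p" "p \<le> 2"
  shows "norm (z + w) powr p \<le> 4 * (norm z powr p + norm w powr p)"
proof -
  define m where "m = max (norm z) (norm w)"
  have "norm (z + w) powr p \<le> (2 * m) powr p"
    using p norm_triangle_ineq[of z w] by (intro powr_mono2) (auto simp: m_def)
  also have "\<dots> = 2 powr p * m powr p" by (simp add: powr_mult m_def)
  also have "\<dots> \<le> 2 powr 2 * m powr p"
    using p by (intro mult_right_mono powr_mono) auto
  also have "m powr p \<le> norm z powr p + norm w powr p" by (auto simp: m_def max_def)
  finally show ?thesis by simp
qed

text \<open>One step of the von Bahr--Esseen inequality.\<close>
lemma (in prob_space) moment_add_independent_le:
  fixes U V :: "'a \<Rightarrow> 'u" and s r y :: "'u \<Rightarrow> complex" and p :: real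
  assumes p: "1 < p" "p \<le> 2"
    and ind: "indep_var N U N' V"
    and meas[measurable]: "s \<in> borel_measurable N" "r \<in> borel_measurable N" "y \<in> borel_measurable N'"
    and S: "integrable M (\<lambda>\<omega>. norm (s (U \<omega>)) powr p)"
    and A: "integrable M (\<lambda>\<omega>. norm (r (U \<omega>)) powr p)"
    and Y: "integrable M (\<lambda>\<omega>. norm (y (V \<omega>)) powr p)"
      "integrable M (\<lambda>\<omega>. y (V \<omega>))" "expectation (\<lambda>\<omega>. y (V \<omega>)) = 0"
  shows "integrable M (\<lambda>\<omega>. norm (s (U \<omega>) + r (U \<omega>) * y (V \<omega>)) powr p)" (is ?int)
    and "expectation (\<lambda>\<omega>. norm (s (U \<omega>) + r (U \<omega>) * y (V \<omega>)) powr p)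
      \<le> expectation (\<lambda>\<omega>. norm (s (U \<omega>)) powr p)
        + 6 * (expectation (\<lambda>\<omega>. norm (r (U \<omega>)) powr p) * expectation (\<lambda>\<omega>. norm (y (V \<omega>)) powr p))"
    (is "?L \<le> ?R")
proof -
  have [measurable]: "U \<in> M \<rightarrow>\<^sub>M N" "V \<in> M \<rightarrow>\<^sub>M N'"
    using indep_var_rv1[OF ind] indep_var_rv2[OF ind] by auto
  \<comment> \<open>\<open>g (U \<omega>) * y (V \<omega>)\<close> is the linear term of
    \<open>norm_add_powr_le\<close> for \<open>z = s (U \<omega>)\<close> and
    \<open>w = r (U \<omega>) * y (V \<omega>)\<close>. Once \<open>g (U \<omega>)\<close> is known
    to be integrable, independence factors its mean, and the factor coming from \<open>y\<close> is
    0.\<close>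
  define g where "g u = cnj (s u) * complex_of_real (norm (s u) powr (p - 2)) * r u" for u
  have cnj_m: "cnj \<in> borel_measurable borel"
    by (intro borel_measurable_continuous_onI continuous_intros)
  have [measurable]: "(\<lambda>u. cnj (s u)) \<in> borel_measurable N"
    by (rule measurable_compose[OF meas(1) cnj_m])
  have g[measurable]: "g \<in> borel_measurable N"
    unfolding g_def by measurable
  have ind1: "indep_var borel (\<lambda>\<omega>. g (U \<omega>)) borel (\<lambda>\<omega>. y (V \<omega>))"
    using indep_var_compose[OF ind g meas(3)] by (simp add: comp_def)
  have ind2: "indep_var borel (\<lambda>\<omega>. norm (r (U \<omega>)) powr p) borel (\<lambda>\<omega>. norm (y (V \<omega>)) powr p)"
    using indep_var_compose[OF ind, of "\<lambda>u. norm (r u) powr p" borel "\<lambda>v. norm (y v) powr p" borel]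
    by (simp add: comp_def)
  have ng: "norm (g u) \<le> norm (s u) powr p + norm (r u) powr p" for u
  proof -
    define m where "m = max (norm (s u)) (norm (r u))"
    have "norm (g u) = (norm (s u) * norm (s u) powr (p - 2)) * norm (r u)"
      by (simp add: g_def norm_mult)
    also have "norm (s u) * norm (s u) powr (p - 2) = norm (s u) powr (p - 1)"
      using powr_mult_base[of "norm (s u)" "p - 2"] by simp
    also have "norm (s u) powr (p - 1) * norm (r u) \<le> m powr (p - 1) * m"
      using p by (intro mult_mono powr_mono2) (auto simp: m_def)
    also have "\<dots> = m powr p"
      using powr_mult_base[of m "p - 1"] by (simp add: m_def le_max_iff_disj mult.commute)
    also have "\<dots> \<le> norm (s u) powr p + norm (r u) powr p" by (auto simp: m_def max_def)
    finally show ?thesis .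
  qed
  have gi: "integrable M (\<lambda>\<omega>. g (U \<omega>))"
  proof (rule Bochner_Integration.integrable_bound[OF Bochner_Integration.integrable_add[OF S A]])
    show "AE \<omega> in M. norm (g (U \<omega>)) \<le> norm (norm (s (U \<omega>)) powr p + norm (r (U \<omega>)) powr p)"
      using ng by (auto intro!: AE_I2)
  qed measurable
  have gY: "integrable M (\<lambda>\<omega>. g (U \<omega>) * y (V \<omega>))" "expectation (\<lambda>\<omega>. g (U \<omega>) * y (V \<omega>)) = 0"
    using indep_var_integrable[OF ind1 gi Y(2)] indep_var_lebesgue_integral[OF ind1 gi Y(2)] Y(3) by auto
  note AY = indep_var_integrable[OF ind2 A Y(1)] indep_var_lebesgue_integral[OF ind2 A Y(1)]
  define b where "b \<omega> = norm (s (U \<omega>)) powr p + p * Re (g (U \<omega>) * y (V \<omega>))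
      + 6 * (norm (r (U \<omega>)) powr p * norm (y (V \<omega>)) powr p)" for \<omega>
  have le: "norm (s (U \<omega>) + r (U \<omega>) * y (V \<omega>)) powr p \<le> b \<omega>" for \<omega>
    using norm_add_powr_le[OF p, of "s (U \<omega>)" "r (U \<omega>) * y (V \<omega>)"]
    by (simp add: g_def b_def norm_mult powr_mult mult.assoc)
  have ri: "integrable M b"
    unfolding b_def using S gY(1) AY(1)
    by (intro Bochner_Integration.integrable_add integrable_mult_right integrable_Re) auto
  show int: ?int
  proof (rule Bochner_Integration.integrable_bound[OF ri])
    show "AE \<omega> in M. norm (norm (s (U \<omega>) + r (U \<omega>) * y (V \<omega>)) powr p) \<le> norm (b \<omega>)"
      using le by (auto intro!: AE_I2 intro: order_trans[OF le])
  qed measurable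
  have "?L \<le> expectation b"
    by (rule integral_mono[OF int ri le])
  also have "\<dots> = ?R"
  proof -
    define h where "h \<omega> = g (U \<omega>) * y (V \<omega>)" for \<omega>
    have "integrable M h" "expectation h = 0" using gY unfolding h_def by auto
    then show ?thesis
      unfolding b_def h_def[symmetric] using S AY by simp
  qed
  finally show "?L \<le> ?R" .
qed

section \<open>Exponentials of a standard normal variable\<close>

text \<open>For \<open>z = s + \<i> t\<close>, translating the variable by \<open>s\<close>
  completes the real square and leaves the characteristic function of the standard normal law at
  \<open>t\<close>.\<close>

lemma has_bochner_integral_std_normal_exp:
  fixes z :: complex
  shows "has_bochner_integral lborel (\<lambda>x. std_normal_density x *\<^sub>R exp (z * of_real x)) (exp (z\<^sup>2 / 2))"
proof -
  define s t where "s = Re z" and "t = Im z"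
  have z: "z = of_real s + \<i> * of_real t" by (simp add: s_def t_def complex_eq_iff)
  have ch: "has_bochner_integral lborel (\<lambda>x. std_normal_density x *\<^sub>R iexp (t * x)) (exp (- (t\<^sup>2) / 2))"
  proof -
    have "integrable std_normal_distribution (\<lambda>x. iexp (t * x))"
      by (intro finite_measure.integrable_const_bound[where B = 1] prob_space.finite_measure
            real_distribution.axioms(1)) (auto intro: real_dist_normal_dist prob_space_normal_density)
    moreover have "(CLINT x|std_normal_distribution. iexp (t * x)) = exp (- (t\<^sup>2) / 2)"
      using fun_cong[OF char_std_normal_distribution, of t] by (simp add: char_def)
    ultimately show ?thesis
      by (simp add: has_bochner_integral_iff integrable_density integral_density)
  qed
  have eq: "std_normal_density (s + 1 * x) *\<^sub>R exp (z * of_real (s + 1 * x))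
    = exp (of_real (s\<^sup>2 / 2) + \<i> * of_real (s * t)) * (std_normal_density x *\<^sub>R iexp (t * x))" for x
  proof -
    have *: "complex_of_real (- (s + x)\<^sup>2 / 2) + z * of_real (s + x)
      = (of_real (s\<^sup>2 / 2) + \<i> * of_real (s * t)) + (of_real (- x\<^sup>2 / 2) + \<i> * of_real (t * x))"
      unfolding z by (simp add: power2_eq_square field_simps)
    have "complex_of_real (std_normal_density (s + x)) * exp (z * of_real (s + x))
      = of_real (1 / sqrt (2 * pi)) * exp (of_real (- (s + x)\<^sup>2 / 2) + z * of_real (s + x))"
      unfolding std_normal_density_def exp_add exp_of_real by simp
    also have "\<dots> = exp (of_real (s\<^sup>2 / 2) + \<i> * of_real (s * t))
        * (complex_of_real (std_normal_density x) * iexp (t * x))"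
      unfolding std_normal_density_def * exp_add[of "of_real (s\<^sup>2 / 2) + \<i> * of_real (s * t)"]
        exp_add[of "of_real (- x\<^sup>2 / 2)"] exp_of_real by simp
    finally show ?thesis by (simp add: scaleR_conv_of_real)
  qed
  have "exp (of_real (s\<^sup>2 / 2) + \<i> * of_real (s * t)) * of_real (exp (- (t\<^sup>2) / 2)) = exp (z\<^sup>2 / 2)"
    unfolding exp_of_real[symmetric] exp_add[symmetric]
    by (rule arg_cong[of _ _ exp]) (simp add: z power2_eq_square field_simps)
  then have "has_bochner_integral lborel
      (\<lambda>x. std_normal_density (s + 1 * x) *\<^sub>R exp (z * of_real (s + 1 * x))) (exp (z\<^sup>2 / 2) /\<^sub>R \<bar>1\<bar>)"
    unfolding eq using has_bochner_integral_mult_right[OF ch, of "exp (of_real (s\<^sup>2 / 2) + \<i> * of_real (s * t))"]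
    by simp
  then show ?thesis
    by (subst lborel_has_bochner_integral_real_affine_iff[where c = 1 and t = s]) auto
qed

lemma (in prob_space) std_normal_exp:
  fixes z :: complex
  assumes X: "distributed M lborel X std_normal_density"
  shows "integrable M (\<lambda>\<omega>. exp (z * of_real (X \<omega>)))"
    and "expectation (\<lambda>\<omega>. exp (z * of_real (X \<omega>))) = exp (z\<^sup>2 / 2)"
proof -
  have XM[measurable]: "X \<in> M \<rightarrow>\<^sub>M lborel" using X by (rule distributed_measurable)
  have D: "distr M lborel X = density lborel std_normal_density"
    using X by (rule distributed_distr_eq_density)
  have "has_bochner_integral (distr M lborel X) (\<lambda>x. exp (z * of_real x)) (exp (z\<^sup>2 / 2))"
    unfolding D using has_bochner_integral_std_normal_exp[of z]
    by (simp add: has_bochner_integral_iff integrable_density integral_density)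
  moreover have "(\<lambda>x. exp (z * of_real x)) \<in> borel_measurable lborel"
    by measurable
  ultimately show "integrable M (\<lambda>\<omega>. exp (z * of_real (X \<omega>)))"
    "expectation (\<lambda>\<omega>. exp (z * of_real (X \<omega>))) = exp (z\<^sup>2 / 2)"
    using integrable_distr_eq[OF XM, of "\<lambda>x. exp (z * of_real x)"]
      integral_distr[OF XM, of "\<lambda>x. exp (z * of_real x)"]
    by (auto simp: has_bochner_integral_iff)
qed

lemma (in prob_space) std_normal_exp_real:
  fixes s :: real
  assumes X: "distributed M lborel X std_normal_density"
  shows "integrable M (\<lambda>\<omega>. exp (s * X \<omega>))"
    and "expectation (\<lambda>\<omega>. exp (s * X \<omega>)) = exp (s\<^sup>2 / 2)"
proof -
  have eq: "exp (complex_of_real s * of_real (X \<omega>)) = of_real (exp (s * X \<omega>))" for \<omega>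
    by (simp flip: exp_of_real)
  have eq2: "exp ((complex_of_real s)\<^sup>2 / 2) = of_real (exp (s\<^sup>2 / 2))"
    by (simp flip: exp_of_real)
  show "integrable M (\<lambda>\<omega>. exp (s * X \<omega>))"
    using std_normal_exp(1)[OF X, of "of_real s"] unfolding eq
    by (simp add: complex_of_real_integrable_eq)
  show "expectation (\<lambda>\<omega>. exp (s * X \<omega>)) = exp (s\<^sup>2 / 2)"
    using std_normal_exp(2)[OF X, of "of_real s"] unfolding eq eq2
    by (metis integral_complex_of_real of_real_eq_iff)
qed

text \<open>The Wick exponential: the subtracted term is the logarithm of the mean of
  \<open>exp (\<beta> * b * x)\<close> under a standard normal \<open>x\<close>, so the mean becomes
  1. It contains the complex square of \<beta>, which keeps the function holomorphic in
  \<beta>.\<close>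

definition wick_exp :: "complex \<Rightarrow> real \<Rightarrow> real \<Rightarrow> complex" where
  "wick_exp \<beta> b x = exp (\<beta> * of_real (b * x) - \<beta>\<^sup>2 * of_real (b\<^sup>2) / 2)"

text \<open>Closed form of the p-th absolute moment of \<open>wick_exp \<beta> b\<close> under the
  standard normal law. The exponent collects \<open>(p * Re \<beta> * b)\<^sup>2 / 2\<close> from
  the real exponential and \<open>- p * ((Re \<beta>)\<^sup>2 - (Im \<beta>)\<^sup>2) * b\<^sup>2 /
  2\<close> from the normalisation.\<close>

definition wick_moment :: "real \<Rightarrow> complex \<Rightarrow> real \<Rightarrow> real" where
  "wick_moment p \<beta> b = exp (b\<^sup>2 / 2 * (p * (p - 1) * (Re \<beta>)\<^sup>2 + p * (Im \<beta>)\<^sup>2))"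

lemma measurable_wick_exp[measurable]: "wick_exp \<beta> b \<in> borel_measurable borel"
  unfolding wick_exp_def by measurable

lemma (in prob_space) wick_exp_std_normal:
  assumes X: "distributed M lborel X std_normal_density"
  shows "integrable M (\<lambda>\<omega>. wick_exp \<beta> b (X \<omega>))"
    and "expectation (\<lambda>\<omega>. wick_exp \<beta> b (X \<omega>)) = 1"
    and "integrable M (\<lambda>\<omega>. norm (wick_exp \<beta> b (X \<omega>)) powr p)"
    and "expectation (\<lambda>\<omega>. norm (wick_exp \<beta> b (X \<omega>)) powr p) = wick_moment p \<beta> b"
proof -
  have 1: "wick_exp \<beta> b x = exp (- ((\<beta> * of_real b)\<^sup>2 / 2)) * exp ((\<beta> * of_real b) * of_real x)" for x
    unfolding wick_exp_def exp_add[symmetric] by (simp add: power_mult_distrib mult.assoc)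
  show "integrable M (\<lambda>\<omega>. wick_exp \<beta> b (X \<omega>))" "expectation (\<lambda>\<omega>. wick_exp \<beta> b (X \<omega>)) = 1"
    unfolding 1 using std_normal_exp[OF X, of "\<beta> * of_real b"]
    by (simp_all add: exp_minus)
  have 2: "norm (wick_exp \<beta> b x) powr p
    = exp (- (p * ((Re \<beta>)\<^sup>2 - (Im \<beta>)\<^sup>2) * b\<^sup>2 / 2)) * exp ((p * Re \<beta> * b) * x)" for x
  proof -
    have "Re (\<beta> * of_real (b * x) - \<beta>\<^sup>2 * of_real (b\<^sup>2) / 2)
      = Re \<beta> * b * x - ((Re \<beta>)\<^sup>2 - (Im \<beta>)\<^sup>2) * b\<^sup>2 / 2"
      by (simp add: power2_eq_square algebra_simps)
    then show ?thesis
      unfolding wick_exp_def norm_exp_eq_Re powr_def exp_add[symmetric]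
      by (simp add: algebra_simps)
  qed
  have 3: "wick_moment p \<beta> b
    = exp (- (p * ((Re \<beta>)\<^sup>2 - (Im \<beta>)\<^sup>2) * b\<^sup>2 / 2)) * exp ((p * Re \<beta> * b)\<^sup>2 / 2)"
    unfolding wick_moment_def exp_add[symmetric]
    by (rule arg_cong[of _ _ exp]) (simp add: power2_eq_square field_simps)
  show "integrable M (\<lambda>\<omega>. norm (wick_exp \<beta> b (X \<omega>)) powr p)"
    "expectation (\<lambda>\<omega>. norm (wick_exp \<beta> b (X \<omega>)) powr p) = wick_moment p \<beta> b"
    unfolding 2 3 using std_normal_exp_real[OF X, of "p * Re \<beta> * b"] by simp_all
qed

lemma wick_moment_ge_1: "1 \<le> p \<Longrightarrow> 1 \<le> wick_moment p \<beta> b"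
  by (simp add: wick_moment_def)

lemma (in prob_space) wick_exp_centered:
  assumes X: "distributed M lborel X std_normal_density" and p: "1 \<le> p" "p \<le> 2"
  shows "integrable M (\<lambda>\<omega>. norm (wick_exp \<beta> b (X \<omega>) - 1) powr p)"
    and "expectation (\<lambda>\<omega>. norm (wick_exp \<beta> b (X \<omega>) - 1) powr p) \<le> 8 * wick_moment p \<beta> b"
proof -
  have [measurable]: "X \<in> borel_measurable M" using distributed_measurable[OF X] by simp
  note W = wick_exp_std_normal(3,4)[OF X, of \<beta> b p]
  have le: "norm (wick_exp \<beta> b x - 1) powr p \<le> 4 * (norm (wick_exp \<beta> b x) powr p + 1)" for x
    using norm_add_powr_le_sum[of p "wick_exp \<beta> b x" "- 1"] p by simp
  have i: "integrable M (\<lambda>\<omega>. 4 * (norm (wick_exp \<beta> b (X \<omega>)) powr p + 1))"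
    using W by simp
  show int: "integrable M (\<lambda>\<omega>. norm (wick_exp \<beta> b (X \<omega>) - 1) powr p)"
  proof (rule Bochner_Integration.integrable_bound[OF i])
    show "AE \<omega> in M. norm (norm (wick_exp \<beta> b (X \<omega>) - 1) powr p)
        \<le> norm (4 * (norm (wick_exp \<beta> b (X \<omega>)) powr p + 1))"
      using le by (auto intro!: AE_I2)
  qed measurable
  have "expectation (\<lambda>\<omega>. norm (wick_exp \<beta> b (X \<omega>) - 1) powr p)
    \<le> expectation (\<lambda>\<omega>. 4 * (norm (wick_exp \<beta> b (X \<omega>)) powr p + 1))"
    by (rule integral_mono[OF int i le])
  also have "\<dots> = 4 * (wick_moment p \<beta> b + 1)"
    using W by (simp add: prob_space)
  also have "\<dots> \<le> 8 * wick_moment p \<beta> b"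
    using wick_moment_ge_1[of p \<beta> b] p by simp
  finally show "expectation (\<lambda>\<omega>. norm (wick_exp \<beta> b (X \<omega>) - 1) powr p) \<le> 8 * wick_moment p \<beta> b" .
qed

text \<open>Truncation at level \<open>s\<close>: a number \<open>x > s\<close> satisfies \<open>x =
  x powr (1 - p) * x powr p \<le> s powr (1 - p) * x powr p\<close>. With \<open>s\<close> fixed,
  vanishing p-th moments thus bring the first moment down to about \<open>s\<close>.\<close>

lemma (in prob_space) nn_integral_norm_le_moment:
  fixes Y :: "'a \<Rightarrow> complex"
  assumes p: "1 \<le> p" and s: "s > 0" and Y[measurable]: "Y \<in> borel_measurable M"
    and i: "integrable M (\<lambda>\<omega>. norm (Y \<omega>) powr p)"
    and le: "expectation (\<lambda>\<omega>. norm (Y \<omega>) powr p) \<le> c"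
  shows "(\<integral>\<^sup>+\<omega>. ennreal (norm (Y \<omega>)) \<partial>M) \<le> ennreal (s + s powr (1 - p) * c)"
proof -
  have pt: "x \<le> s + s powr (1 - p) * x powr p" if "x \<ge> 0" for x
  proof (cases "x \<le> s")
    case True
    then show ?thesis by (smt (verit) powr_ge_zero mult_nonneg_nonneg)
  next
    case False
    have "x = x powr (1 - p) * x powr p" using False s by (simp flip: powr_add)
    also have "\<dots> \<le> s powr (1 - p) * x powr p"
      using False s p by (intro mult_right_mono powr_mono2') auto
    finally show ?thesis using s by simp
  qed
  have "(\<integral>\<^sup>+\<omega>. ennreal (norm (Y \<omega>)) \<partial>M) \<le> (\<integral>\<^sup>+\<omega>. ennreal (s + s powr (1 - p) * norm (Y \<omega>) powr p) \<partial>M)"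
    by (intro nn_integral_mono ennreal_leI pt) simp
  also have "\<dots> = ennreal (expectation (\<lambda>\<omega>. s + s powr (1 - p) * norm (Y \<omega>) powr p))"
    using i s by (intro nn_integral_eq_integral) (auto intro!: AE_I2)
  also have "expectation (\<lambda>\<omega>. s + s powr (1 - p) * norm (Y \<omega>) powr p)
      = s + s powr (1 - p) * expectation (\<lambda>\<omega>. norm (Y \<omega>) powr p)"
    using i by (simp add: prob_space)
  also have "ennreal \<dots> \<le> ennreal (s + s powr (1 - p) * c)"
    using le by (intro ennreal_leI add_left_mono mult_left_mono) auto
  finally show ?thesis .
qed

section \<open>Weights on the tree\<close>

text \<open>The singletons \<open>{f l}\<close> are disjoint blocks of indices, so the block
  variables are independent, and so are their single coordinates. It is applied to the prefixes of
  one path.\<close>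

lemma (in prob_space) indep_vars_reindex:
  assumes ind: "indep_vars M' X I" and f: "inj_on f L" "f ` L \<subseteq> I"
  shows "indep_vars (\<lambda>l. M' (f l)) (\<lambda>l. X (f l)) L"
proof -
  have "indep_vars (\<lambda>l. PiM {f l} M') (\<lambda>l \<omega>. restrict (\<lambda>i. X i \<omega>) {f l}) L"
    using f by (intro indep_vars_restrict[OF ind]) (auto simp: disjoint_family_on_def inj_on_def)
  then have "indep_vars (\<lambda>l. M' (f l)) (\<lambda>l \<omega>. restrict (\<lambda>i. X i \<omega>) {f l} (f l)) L"
    by (rule indep_vars_compose2) (intro measurable_component_singleton, simp)
  then show ?thesis by simp
qed

section \<open>Levels and nodes of the index tree\<close>

lemma grem_level_0: "grem_level N n 0 = {[]}"
  by (auto simp: grem_level_def)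

lemma grem_level_Suc:
  "grem_level N n (Suc j) = (\<lambda>(\<epsilon>, k). \<epsilon> @ [k]) ` (grem_level N n j \<times> {1..N n (Suc j)})"
proof
  show "grem_level N n (Suc j) \<subseteq> (\<lambda>(\<epsilon>, k). \<epsilon> @ [k]) ` (grem_level N n j \<times> {1..N n (Suc j)})"
  proof
    fix \<epsilon> assume \<epsilon>: "\<epsilon> \<in> grem_level N n (Suc j)"
    then have "\<epsilon> = take j \<epsilon> @ [\<epsilon> ! j]"
      by (simp add: grem_level_def take_Suc_conv_app_nth[symmetric])
    moreover have "take j \<epsilon> \<in> grem_level N n j" "\<epsilon> ! j \<in> {1..N n (Suc j)}"
      using \<epsilon> by (auto simp: grem_level_def dest: bspec[of _ _ "Suc j"])
    ultimately show "\<epsilon> \<in> (\<lambda>(\<epsilon>, k). \<epsilon> @ [k]) ` (grem_level N n j \<times> {1..N n (Suc j)})"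
      by (metis (no_types, lifting) SigmaI case_prod_conv image_eqI)
  qed
  show "(\<lambda>(\<epsilon>, k). \<epsilon> @ [k]) ` (grem_level N n j \<times> {1..N n (Suc j)}) \<subseteq> grem_level N n (Suc j)"
  proof clarify
    fix \<epsilon> k assume \<epsilon>: "\<epsilon> \<in> grem_level N n j" and k: "k \<in> {1..N n (Suc j)}"
    have "1 \<le> (\<epsilon> @ [k]) ! (i - 1) \<and> (\<epsilon> @ [k]) ! (i - 1) \<le> N n i" if "i \<in> {1..Suc j}" for i
    proof (cases "i = Suc j")
      case True then show ?thesis using \<epsilon> k by (simp add: grem_level_def nth_append)
    next
      case False
      then have "i \<in> {1..j}" using that by auto
      moreover from this have "i - 1 < j" by auto
      ultimately show ?thesis using \<epsilon> by (simp add: grem_level_def nth_append)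
    qed
    then show "\<epsilon> @ [k] \<in> grem_level N n (Suc j)"
      using \<epsilon> by (simp add: grem_level_def)
  qed
qed

lemma inj_on_snoc: "inj_on (\<lambda>(\<epsilon>, k). \<epsilon> @ [k]) A"
  by (auto simp: inj_on_def)

lemma finite_grem_level: "finite (grem_level N n j)"
  by (induction j) (auto simp: grem_level_0 grem_level_Suc)

lemma card_grem_level: "card (grem_level N n j) = (\<Prod>i=1..j. N n i)"
proof (induction j)
  case (Suc j)
  then show ?case
    by (simp add: grem_level_Suc card_image[OF inj_on_snoc] card_cartesian_product
        prod.nat_ivl_Suc')
qed (simp add: grem_level_0)

lemma length_grem_level: "\<epsilon> \<in> grem_level N n j \<Longrightarrow> length \<epsilon> = j"
  by (simp add: grem_level_def)

lemma take_grem_level: "\<epsilon> \<in> grem_level N n m \<Longrightarrow> i \<le> m \<Longrightarrow> take i \<epsilon> \<in> grem_level N n i"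
  by (auto simp: grem_level_def)

lemma take_grem_nodes:
  "\<epsilon> \<in> grem_level N n m \<Longrightarrow> i \<in> {1..j} \<Longrightarrow> j \<le> m \<Longrightarrow> take i \<epsilon> \<in> grem_nodes j N n"
  by (auto simp: grem_nodes_def intro!: bexI[of _ i] take_grem_level)

lemma grem_nodes_mono: "j \<le> d \<Longrightarrow> grem_nodes j N n \<subseteq> grem_nodes d N n"
  by (force simp: grem_nodes_def)

lemma grem_level_subset_nodes: "1 \<le> j \<Longrightarrow> j \<le> d \<Longrightarrow> grem_level N n j \<subseteq> grem_nodes d N n"
  by (auto simp: grem_nodes_def)

lemma grem_level_Suc_disjoint_nodes: "grem_level N n (Suc j) \<inter> grem_nodes j N n = {}"
  by (auto simp: grem_nodes_def grem_level_def)

section \<open>Weights along branches and their averages over a level\<close>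

text \<open>The index may be longer than \<open>j\<close>, since only its prefixes of lengths 1 to
  \<open>j\<close> are read; a child can therefore carry the weight of its parent. The node values
  are an explicit argument \<open>x\<close>, so that measurability and independence follow from the
  set of coordinates that are read.\<close>

definition branch_weight ::
  "complex \<Rightarrow> (nat \<Rightarrow> real) \<Rightarrow> nat \<Rightarrow> nat list \<Rightarrow> (nat list \<Rightarrow> real) \<Rightarrow> complex" where
  "branch_weight \<beta> b j \<epsilon> x = (\<Prod>i=1..j. wick_exp \<beta> (b i) (x (take i \<epsilon>)))"

definition level_weight ::
  "complex \<Rightarrow> (nat \<Rightarrow> real) \<Rightarrow> (nat \<Rightarrow> nat \<Rightarrow> nat) \<Rightarrow> nat \<Rightarrow> nat \<Rightarrow> (nat list \<Rightarrow> real) \<Rightarrow> complex" where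
  "level_weight \<beta> b N n j x =
     (\<Sum>\<epsilon>\<in>grem_level N n j. branch_weight \<beta> b j \<epsilon> x) / of_nat (\<Prod>i=1..j. N n i)"

lemma branch_weight_cong:
  "(\<And>i. i \<in> {1..j} \<Longrightarrow> x (take i \<epsilon>) = y (take i \<epsilon>)) \<Longrightarrow> branch_weight \<beta> b j \<epsilon> x = branch_weight \<beta> b j \<epsilon> y"
  by (auto simp: branch_weight_def intro!: prod.cong)

lemma level_weight_cong:
  assumes "\<And>\<delta>. \<delta> \<in> grem_nodes j N n \<Longrightarrow> x \<delta> = y \<delta>"
  shows "level_weight \<beta> b N n j x = level_weight \<beta> b N n j y"
proof -
  have "branch_weight \<beta> b j \<epsilon> x = branch_weight \<beta> b j \<epsilon> y" if "\<epsilon> \<in> grem_level N n j" for \<epsilon>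
    using take_grem_nodes[OF that] assms by (intro branch_weight_cong) blast
  then show ?thesis by (simp add: level_weight_def)
qed

lemma measurable_branch_weight:
  "(\<And>i. i \<in> {1..j} \<Longrightarrow> take i \<epsilon> \<in> J) \<Longrightarrow> branch_weight \<beta> b j \<epsilon> \<in> borel_measurable (PiM J (\<lambda>_. borel))"
  unfolding branch_weight_def
  by (intro borel_measurable_prod measurable_compose[OF _ measurable_wick_exp] measurable_component_singleton)

lemma measurable_level_weight:
  assumes "grem_nodes j N n \<subseteq> J"
  shows "level_weight \<beta> b N n j \<in> borel_measurable (PiM J (\<lambda>_. borel))"
proof -
  have "branch_weight \<beta> b j \<epsilon> \<in> borel_measurable (PiM J (\<lambda>_. borel))" if "\<epsilon> \<in> grem_level N n j" for \<epsilon>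
    using take_grem_nodes[OF that] assms by (intro measurable_branch_weight) blast
  then show ?thesis
    unfolding level_weight_def
    by (intro borel_measurable_divide borel_measurable_sum borel_measurable_const)
qed

lemma level_weight_0: "level_weight \<beta> b N n 0 x = 1"
  by (simp add: level_weight_def grem_level_0 branch_weight_def)

text \<open>The martingale decomposition. Each parent has \<open>N n (Suc j)\<close> children, so
  averaging the parents' weights over level \<open>Suc j\<close> returns \<open>level_weight\<close>
  of level \<open>j\<close>; what remains is a sum over the new nodes, each term with its own
  centered factor.\<close>

lemma level_weight_Suc:
  assumes N: "N n (Suc j) > 0"
  shows "level_weight \<beta> b N n (Suc j) x = level_weight \<beta> b N n j x
    + (\<Sum>\<epsilon>\<in>grem_level N n (Suc j). branch_weight \<beta> b j \<epsilon> x / of_nat (\<Prod>i=1..Suc j. N n i)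
        * (wick_exp \<beta> (b (Suc j)) (x \<epsilon>) - 1))"
proof -
  let ?C = "of_nat (\<Prod>i=1..Suc j. N n i) :: complex"
  have C: "?C = of_nat (\<Prod>i=1..j. N n i) * of_nat (N n (Suc j))"
    by (simp add: prod.nat_ivl_Suc')
  have "(\<Sum>\<epsilon>\<in>grem_level N n (Suc j). branch_weight \<beta> b j \<epsilon> x)
    = (\<Sum>(\<epsilon>, k)\<in>grem_level N n j \<times> {1..N n (Suc j)}. branch_weight \<beta> b j (\<epsilon> @ [k]) x)"
    unfolding grem_level_Suc by (subst sum.reindex[OF inj_on_snoc]) (simp add: case_prod_beta comp_def)
  also have "\<dots> = (\<Sum>(\<epsilon>, k)\<in>grem_level N n j \<times> {1..N n (Suc j)}. branch_weight \<beta> b j \<epsilon> x)"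
    by (intro sum.cong refl) (auto simp: branch_weight_def length_grem_level)
  also have "\<dots> = of_nat (N n (Suc j)) * (\<Sum>\<epsilon>\<in>grem_level N n j. branch_weight \<beta> b j \<epsilon> x)"
    by (simp flip: sum.cartesian_product add: sum_distrib_left)
  finally have 1: "(\<Sum>\<epsilon>\<in>grem_level N n (Suc j). branch_weight \<beta> b j \<epsilon> x) / ?C = level_weight \<beta> b N n j x"
    using N unfolding C level_weight_def by simp
  have 2: "branch_weight \<beta> b (Suc j) \<epsilon> x = branch_weight \<beta> b j \<epsilon> x * wick_exp \<beta> (b (Suc j)) (x \<epsilon>)"
    if "\<epsilon> \<in> grem_level N n (Suc j)" for \<epsilon>
    using that by (simp add: branch_weight_def prod.nat_ivl_Suc' length_grem_level mult.commute)
  have "level_weight \<beta> b N n (Suc j) x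
    = (\<Sum>\<epsilon>\<in>grem_level N n (Suc j). branch_weight \<beta> b j \<epsilon> x * wick_exp \<beta> (b (Suc j)) (x \<epsilon>)) / ?C"
    unfolding level_weight_def using 2 by simp
  also have "\<dots> = (\<Sum>\<epsilon>\<in>grem_level N n (Suc j). branch_weight \<beta> b j \<epsilon> x) / ?C
      + (\<Sum>\<epsilon>\<in>grem_level N n (Suc j). branch_weight \<beta> b j \<epsilon> x / ?C * (wick_exp \<beta> (b (Suc j)) (x \<epsilon>) - 1))"
    unfolding sum_divide_distrib sum.distrib[symmetric]
    by (intro sum.cong refl) (simp add: algebra_simps diff_divide_distrib)
  finally show ?thesis unfolding 1 .
qed

section \<open>Moment bounds for a fixed tree of Gaussian variables\<close>

locale gaussian_tree = prob_space M for M :: "'a measure" +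
  fixes d :: nat and N :: "nat \<Rightarrow> nat \<Rightarrow> nat" and n :: nat and X :: "nat list \<Rightarrow> 'a \<Rightarrow> real"
  assumes indep: "indep_vars (\<lambda>_. borel) X (grem_nodes d N n)"
    and normal: "\<epsilon> \<in> grem_nodes d N n \<Longrightarrow> distributed M lborel (X \<epsilon>) std_normal_density"
begin

text \<open>Prefixes of different lengths are different nodes, so the factors along a path are
  independent and means multiply. The path is allowed to end at a level \<open>m\<close> beyond
  \<open>j\<close>, as the increments at level \<open>Suc j\<close> require.\<close>

lemma branch_weight_moments:
  assumes \<epsilon>: "\<epsilon> \<in> grem_level N n m" and j: "j \<le> m" "m \<le> d"
  shows "integrable M (\<lambda>\<omega>. branch_weight \<beta> b j \<epsilon> (\<lambda>\<delta>. X \<delta> \<omega>))"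
    and "expectation (\<lambda>\<omega>. branch_weight \<beta> b j \<epsilon> (\<lambda>\<delta>. X \<delta> \<omega>)) = 1"
    and "integrable M (\<lambda>\<omega>. norm (branch_weight \<beta> b j \<epsilon> (\<lambda>\<delta>. X \<delta> \<omega>)) powr p)"
    and "expectation (\<lambda>\<omega>. norm (branch_weight \<beta> b j \<epsilon> (\<lambda>\<delta>. X \<delta> \<omega>)) powr p)
      = (\<Prod>i=1..j. wick_moment p \<beta> (b i))"
proof -
  have T: "take i \<epsilon> \<in> grem_nodes d N n" if "i \<in> {1..j}" for i
    using take_grem_nodes[OF \<epsilon> that j(1)] grem_nodes_mono[of j d] j by auto
  have "inj_on (\<lambda>i. take i \<epsilon>) {1..j}"
    using length_grem_level[OF \<epsilon>] j by (auto simp: inj_on_def dest: arg_cong[of _ _ length])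
  then have ind: "indep_vars (\<lambda>_. borel) (\<lambda>i. X (take i \<epsilon>)) {1..j}"
    using T by (intro indep_vars_reindex[OF indep]) auto
  note ind1 = indep_vars_compose2[OF ind, of "\<lambda>i. wick_exp \<beta> (b i)" "\<lambda>_. borel"]
  note ind2 = indep_vars_compose2[OF ind, of "\<lambda>i x. norm (wick_exp \<beta> (b i) x) powr p" "\<lambda>_. borel"]
  note W = wick_exp_std_normal[OF normal[OF T], of _ \<beta>]
  show "integrable M (\<lambda>\<omega>. branch_weight \<beta> b j \<epsilon> (\<lambda>\<delta>. X \<delta> \<omega>))"
    "expectation (\<lambda>\<omega>. branch_weight \<beta> b j \<epsilon> (\<lambda>\<delta>. X \<delta> \<omega>)) = 1"
    unfolding branch_weight_def
    using indep_vars_lebesgue_integral[OF _ ind1] indep_vars_integrable[OF _ ind1] W(1,2) by simp_all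
  have eq: "norm (branch_weight \<beta> b j \<epsilon> x) powr p = (\<Prod>i=1..j. norm (wick_exp \<beta> (b i) (x (take i \<epsilon>))) powr p)" for x
    by (simp add: branch_weight_def prod_norm[symmetric] prod_powr_distrib)
  show "integrable M (\<lambda>\<omega>. norm (branch_weight \<beta> b j \<epsilon> (\<lambda>\<delta>. X \<delta> \<omega>)) powr p)"
    "expectation (\<lambda>\<omega>. norm (branch_weight \<beta> b j \<epsilon> (\<lambda>\<delta>. X \<delta> \<omega>)) powr p)
      = (\<Prod>i=1..j. wick_moment p \<beta> (b i))"
    unfolding eq
    using indep_vars_lebesgue_integral[OF _ ind2] indep_vars_integrable[OF _ ind2] W(3,4) by simp_all
qed

text \<open>The nodes of level \<open>Suc j\<close> are revealed one at a time. A new term is a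
  function of the earlier levels times a centered factor of the new node, which is independent of
  everything revealed before, so \<open>moment_add_independent_le\<close> applies. Its constant 6
  and the 8 from centering in \<open>wick_exp_centered\<close> make 48 per node.\<close>

lemma partial_level_moment_le:
  fixes p :: real and c :: complex
  assumes p: "1 < p" "p \<le> 2" and j: "Suc j \<le> d"
    and W: "integrable M (\<lambda>\<omega>. norm (level_weight \<beta> b N n j (\<lambda>\<delta>. X \<delta> \<omega>) - 1) powr p)"
    and "finite B" "B \<subseteq> grem_level N n (Suc j)"
  defines "T \<equiv> \<lambda>B x. level_weight \<beta> b N n j x - 1
      + (\<Sum>\<epsilon>\<in>B. branch_weight \<beta> b j \<epsilon> x / c * (wick_exp \<beta> (b (Suc j)) (x \<epsilon>) - 1))"
  shows "integrable M (\<lambda>\<omega>. norm (T B (\<lambda>\<delta>. X \<delta> \<omega>)) powr p) \<and>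
    expectation (\<lambda>\<omega>. norm (T B (\<lambda>\<delta>. X \<delta> \<omega>)) powr p)
     \<le> expectation (\<lambda>\<omega>. norm (level_weight \<beta> b N n j (\<lambda>\<delta>. X \<delta> \<omega>) - 1) powr p)
       + card B * (48 * norm c powr (- p) * (\<Prod>i=1..Suc j. wick_moment p \<beta> (b i)))"
  using \<open>finite B\<close> \<open>B \<subseteq> grem_level N n (Suc j)\<close>
proof (induction B rule: finite_induct)
  case empty
  then show ?case using W by (simp add: T_def)
next
  case (insert \<epsilon> B)
  \<comment> \<open>\<open>J\<close> holds all nodes revealed so far: the first \<open>j\<close>
    levels and the part \<open>B\<close> of the next one. Independence is available for the families
    restricted to \<open>J\<close> and to the new node; \<open>sr\<close> and \<open>br\<close>
    below remove the restrictions, because only coordinates in \<open>J\<close> are read.\<close>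
  define J where "J = grem_nodes j N n \<union> B"
  have \<epsilon>: "\<epsilon> \<in> grem_level N n (Suc j)" using insert by auto
  have \<epsilon>d: "\<epsilon> \<in> grem_nodes d N n" using grem_level_subset_nodes[of "Suc j" d N n] j \<epsilon> by auto
  have "J \<subseteq> grem_nodes d N n" "{\<epsilon>} \<subseteq> grem_nodes d N n" "J \<inter> {\<epsilon>} = {}"
    using grem_nodes_mono[of j d N n] grem_level_subset_nodes[of "Suc j" d N n] j insert
      grem_level_Suc_disjoint_nodes[of N n j]
    by (auto simp: J_def)
  then have ind: "indep_var (PiM J (\<lambda>_. borel)) (\<lambda>\<omega>. restrict (\<lambda>\<delta>. X \<delta> \<omega>) J)
      (PiM {\<epsilon>} (\<lambda>_. borel)) (\<lambda>\<omega>. restrict (\<lambda>\<delta>. X \<delta> \<omega>) {\<epsilon>})"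
    by (intro indep_var_restrict[OF indep]) auto
  have TJ: "take i \<delta> \<in> J" if "\<delta> \<in> grem_level N n (Suc j)" "i \<in> {1..j}" for i \<delta>
    using take_grem_nodes[OF that] by (auto simp: J_def)
  define y where "y v = wick_exp \<beta> (b (Suc j)) (v \<epsilon>) - 1" for v :: "nat list \<Rightarrow> real"
  have bm: "branch_weight \<beta> b j \<delta> \<in> borel_measurable (PiM J (\<lambda>_. borel))"
    if "\<delta> \<in> grem_level N n (Suc j)" for \<delta>
    using TJ[OF that] by (intro measurable_branch_weight) auto
  have sm: "T B \<in> borel_measurable (PiM J (\<lambda>_. borel))"
    unfolding T_def
    by (intro borel_measurable_add borel_measurable_diff borel_measurable_sum borel_measurable_times
        borel_measurable_divide borel_measurable_const measurable_level_weight
        measurable_compose[OF _ measurable_wick_exp] measurable_component_singleton bm)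
       (use insert in \<open>auto simp: J_def\<close>)
  have rm: "(\<lambda>u. branch_weight \<beta> b j \<epsilon> u / c) \<in> borel_measurable (PiM J (\<lambda>_. borel))"
    using bm[OF \<epsilon>] by simp
  have ym: "y \<in> borel_measurable (PiM {\<epsilon>} (\<lambda>_. borel))"
    unfolding y_def by (intro borel_measurable_diff borel_measurable_const
        measurable_compose[OF _ measurable_wick_exp] measurable_component_singleton) simp
  have br: "branch_weight \<beta> b j \<delta> (restrict x J) = branch_weight \<beta> b j \<delta> x"
    if "\<delta> \<in> grem_level N n (Suc j)" for \<delta> x
    using TJ[OF that] by (intro branch_weight_cong) auto
  have sr: "T B (restrict x J) = T B x" for x
  proof -
    have "level_weight \<beta> b N n j (restrict x J) = level_weight \<beta> b N n j x"
      by (rule level_weight_cong) (auto simp: J_def)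
    moreover have "(\<Sum>\<epsilon>\<in>B. branch_weight \<beta> b j \<epsilon> (restrict x J) / c * (wick_exp \<beta> (b (Suc j)) (restrict x J \<epsilon>) - 1))
      = (\<Sum>\<epsilon>\<in>B. branch_weight \<beta> b j \<epsilon> x / c * (wick_exp \<beta> (b (Suc j)) (x \<epsilon>) - 1))"
    proof (rule sum.cong[OF refl])
      fix \<delta> assume "\<delta> \<in> B"
      then have "\<delta> \<in> grem_level N n (Suc j)" "\<delta> \<in> J" using insert by (auto simp: J_def)
      then show "branch_weight \<beta> b j \<delta> (restrict x J) / c * (wick_exp \<beta> (b (Suc j)) (restrict x J \<delta>) - 1)
        = branch_weight \<beta> b j \<delta> x / c * (wick_exp \<beta> (b (Suc j)) (x \<delta>) - 1)"
        using br by simp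
    qed
    ultimately show ?thesis by (simp add: T_def)
  qed
  note mom = branch_weight_moments[OF \<epsilon> _ j, of j \<beta> b]
  have bwc: "norm (z / c) powr p = norm c powr (- p) * norm z powr p" for z
    by (simp add: norm_divide powr_divide powr_minus field_simps)
  note cen = wick_exp_centered[OF normal[OF \<epsilon>d] less_imp_le[OF p(1)] p(2), of \<beta> "b (Suc j)"]
  note we = wick_exp_std_normal(1,2)[OF normal[OF \<epsilon>d], of \<beta> "b (Suc j)"]
  have TB: "T (insert \<epsilon> B) x = T B x + branch_weight \<beta> b j \<epsilon> x / c * y x" for x
    using insert by (simp add: T_def y_def)
  note step = moment_add_independent_le[OF p ind sm rm ym, unfolded sr br[OF \<epsilon>] y_def, simplified]
  have IH: "integrable M (\<lambda>\<omega>. norm (T B (\<lambda>\<delta>. X \<delta> \<omega>)) powr p)"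
    "expectation (\<lambda>\<omega>. norm (T B (\<lambda>\<delta>. X \<delta> \<omega>)) powr p)
     \<le> expectation (\<lambda>\<omega>. norm (level_weight \<beta> b N n j (\<lambda>\<delta>. X \<delta> \<omega>) - 1) powr p)
       + card B * (48 * norm c powr (- p) * (\<Prod>i=1..Suc j. wick_moment p \<beta> (b i)))"
    using insert by auto
  have ri: "integrable M (\<lambda>\<omega>. norm (branch_weight \<beta> b j \<epsilon> (\<lambda>\<delta>. X \<delta> \<omega>) / c) powr p)"
    "expectation (\<lambda>\<omega>. norm (branch_weight \<beta> b j \<epsilon> (\<lambda>\<delta>. X \<delta> \<omega>) / c) powr p)
      = norm c powr (- p) * (\<Prod>i=1..j. wick_moment p \<beta> (b i))"
    unfolding bwc using mom(3,4)[of p] by auto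
  have yi: "integrable M (\<lambda>\<omega>. wick_exp \<beta> (b (Suc j)) (X \<epsilon> \<omega>) - 1)"
    "expectation (\<lambda>\<omega>. wick_exp \<beta> (b (Suc j)) (X \<epsilon> \<omega>) - 1) = 0"
    using we by (simp_all add: prob_space)
  have "integrable M (\<lambda>\<omega>. norm (T (insert \<epsilon> B) (\<lambda>\<delta>. X \<delta> \<omega>)) powr p)"
    unfolding TB y_def using step(1)[OF IH(1) ri(1) cen(1) yi] by simp
  moreover have "expectation (\<lambda>\<omega>. norm (T (insert \<epsilon> B) (\<lambda>\<delta>. X \<delta> \<omega>)) powr p)
    \<le> expectation (\<lambda>\<omega>. norm (T B (\<lambda>\<delta>. X \<delta> \<omega>)) powr p)
      + 6 * (norm c powr (- p) * (\<Prod>i=1..j. wick_moment p \<beta> (b i)) *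
          expectation (\<lambda>\<omega>. norm (wick_exp \<beta> (b (Suc j)) (X \<epsilon> \<omega>) - 1) powr p))"
    unfolding TB y_def using step(2)[OF IH(1) ri(1) cen(1) yi] unfolding ri(2) by simp
  moreover have "norm c powr (- p) * (\<Prod>i=1..j. wick_moment p \<beta> (b i)) *
          expectation (\<lambda>\<omega>. norm (wick_exp \<beta> (b (Suc j)) (X \<epsilon> \<omega>) - 1) powr p)
       \<le> norm c powr (- p) * (\<Prod>i=1..j. wick_moment p \<beta> (b i)) * (8 * wick_moment p \<beta> (b (Suc j)))"
    using cen(2) by (intro mult_left_mono mult_nonneg_nonneg prod_nonneg) (auto simp: wick_moment_def)
  moreover have "(\<Prod>i=1..Suc j. wick_moment p \<beta> (b i)) = (\<Prod>i=1..j. wick_moment p \<beta> (b i)) * wick_moment p \<beta> (b (Suc j))"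
    by (simp add: prod.nat_ivl_Suc')
  ultimately show ?case using IH(2) insert.hyps by (simp add: algebra_simps)
qed

text \<open>Induction over the levels, each step adding all nodes of the next level. Level
  \<open>Suc j\<close> has \<open>?C\<close> nodes and every term carries \<open>1 / ?C\<close>, so
  the cost is \<open>?C powr (1 - p)\<close> times the moments, which splits into a product over
  levels.\<close>

lemma level_weight_moment_le:
  fixes p :: real
  assumes p: "1 < p" "p \<le> 2" and N: "\<And>i. i \<in> {1..d} \<Longrightarrow> N n i > 0" and "j \<le> d"
  shows "integrable M (\<lambda>\<omega>. norm (level_weight \<beta> b N n j (\<lambda>\<delta>. X \<delta> \<omega>) - 1) powr p) \<and>
    expectation (\<lambda>\<omega>. norm (level_weight \<beta> b N n j (\<lambda>\<delta>. X \<delta> \<omega>) - 1) powr p)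
     \<le> 48 * (\<Sum>m=1..j. \<Prod>i=1..m. real (N n i) powr (1 - p) * wick_moment p \<beta> (b i))"
  using \<open>j \<le> d\<close>
proof (induction j)
  case 0
  then show ?case by (simp add: level_weight_0)
next
  case (Suc j)
  let ?C = "\<Prod>i=1..Suc j. N n i"
  have C: "?C > 0" using N Suc.prems by (intro prod_pos) auto
  have "norm (of_nat ?C :: complex) powr (- p) * real ?C = real ?C powr (1 - p)"
    unfolding norm_of_nat using powr_mult_base[of "real ?C" "- p"] by (simp only: of_nat_0_le_iff mult.commute) simp
  also have "\<dots> = (\<Prod>i=1..Suc j. real (N n i) powr (1 - p))"
    by (simp only: of_nat_prod prod_powr_distrib of_nat_0_le_iff)
  finally have cn: "norm (of_nat ?C :: complex) powr (- p) * real ?C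
    = (\<Prod>i=1..Suc j. real (N n i) powr (1 - p))" .
  have *: "card (grem_level N n (Suc j)) * (48 * norm (of_nat ?C :: complex) powr (- p)
      * (\<Prod>i=1..Suc j. wick_moment p \<beta> (b i)))
    = 48 * (\<Prod>i=1..Suc j. real (N n i) powr (1 - p) * wick_moment p \<beta> (b i))"
    unfolding card_grem_level prod.distrib cn[symmetric] by (simp only: mult_ac)
  show ?case
    using partial_level_moment_le[OF p Suc.prems _ finite_grem_level order_refl, of \<beta> b "of_nat ?C"] Suc * N[of "Suc j"]
    by (simp add: level_weight_Suc sum.nat_ivl_Suc' algebra_simps del: prod.cl_ivl_Suc)
qed

end

section \<open>Convergence of random analytic functions to a constant\<close>

lemma openin_imp_measurable_set:
  "openin T U \<Longrightarrow> U \<in> sets (borel_of_topology T)"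
  by (auto simp: borel_of_topology_def dest: openin_subset)

lemma space_borel_of_topology: "space (borel_of_topology T) = topspace T"
  unfolding borel_of_topology_def by (rule space_measure_of) (auto dest: openin_subset)

lemma measurable_borel_of_topologyI:
  assumes "f \<in> space M \<rightarrow> topspace T" "\<And>U. openin T U \<Longrightarrow> f -` U \<inter> space M \<in> sets M"
  shows "f \<in> M \<rightarrow>\<^sub>M borel_of_topology T"
  unfolding borel_of_topology_def using assms
  by (intro measurable_measure_of) (auto dest: openin_subset)

lemma continuous_map_borel_measurable:
  assumes "continuous_map T euclideanreal \<phi>"
  shows "\<phi> \<in> borel_measurable (borel_of_topology T)"
proof (rule borel_measurableI)
  fix S :: "real set" assume "open S"
  then have "openin T {x \<in> topspace T. \<phi> x \<in> S}"
    using assms by (auto simp: continuous_map_def)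
  moreover have "\<phi> -` S \<inter> space (borel_of_topology T) = {x \<in> topspace T. \<phi> x \<in> S}"
    by (auto simp: space_borel_of_topology)
  ultimately show "\<phi> -` S \<inter> space (borel_of_topology T) \<in> sets (borel_of_topology T)"
    by (simp add: openin_imp_measurable_set)
qed

text \<open>Joint continuity is uniform in \<open>z\<close> over a compact \<open>K\<close>, so
  \<open>x\<close> is mapped continuously into the topology of locally uniform convergence.
  Preimages of open sets are then open, for arbitrary open \<open>U\<close>, without describing the
  Borel sets by point evaluations.\<close>

lemma measurable_analytic_family:
  fixes F :: "'x::topological_space \<Rightarrow> complex \<Rightarrow> complex"
  assumes cont: "continuous_on UNIV (\<lambda>(x, z). F x z)"
    and hol: "\<And>x. F x holomorphic_on D"
  shows "(\<lambda>x. \<lambda>z\<in>D. F x z) \<in> borel \<rightarrow>\<^sub>M borel_of_topology (analytic_topology D)"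
proof (rule measurable_borel_of_topologyI)
  have an: "(\<lambda>z\<in>D. F x z) \<in> analytic_fun D" for x
  proof -
    have "(\<lambda>z\<in>D. F x z) holomorphic_on D"
      by (rule holomorphic_transform[OF hol[of x]]) simp
    then show ?thesis by (simp add: analytic_fun_def)
  qed
  then show "(\<lambda>x. \<lambda>z\<in>D. F x z) \<in> space borel \<rightarrow> topspace (analytic_topology D)"
    by (simp add: topspace_analytic_topology)
  fix U assume U: "openin (analytic_topology D) U"
  have "open {x. (\<lambda>z\<in>D. F x z) \<in> U}"
  proof (rule open_subopen[THEN iffD2], rule ballI)
    fix x0 assume "x0 \<in> {x. (\<lambda>z\<in>D. F x z) \<in> U}"
    then have x0: "(\<lambda>z\<in>D. F x0 z) \<in> U" by simp
    have "\<forall>f\<in>U. \<exists>K e. compact K \<and> K \<subseteq> D \<and> 0 < (e::real) \<and>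
        (\<forall>g\<in>analytic_fun D. (\<forall>z\<in>K. dist (g z) (f z) < e) \<longrightarrow> g \<in> U)"
      using U unfolding openin_analytic_topology analytic_open_def by (rule conjunct2)
    from bspec[OF this x0] obtain K e where K: "compact K" "K \<subseteq> D" "0 < (e::real)"
      "\<forall>g\<in>analytic_fun D. (\<forall>z\<in>K. dist (g z) ((\<lambda>z\<in>D. F x0 z) z) < e) \<longrightarrow> g \<in> U"
      by (elim exE conjE)
    have c: "continuous_on (UNIV \<times> K) (\<lambda>(x, z). F x z)"
      by (rule continuous_on_subset[OF cont]) auto
    have "0 < e / 2" using K(3) by simp
    then obtain X0 where X0: "x0 \<in> X0" "open X0" "\<forall>x\<in>X0 \<inter> UNIV. \<forall>t\<in>K. dist (F x t) (F x0 t) \<le> e / 2"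
      by (rule continuous_on_prod_compactE[OF c K(1) UNIV_I, of "e / 2" x0, unfolded prod.case])
    have "(\<lambda>z\<in>D. F x z) \<in> U" if "x \<in> X0" for x
    proof (rule K(4)[rule_format, OF an])
      fix z assume "z \<in> K"
      then show "dist ((\<lambda>z\<in>D. F x z) z) ((\<lambda>z\<in>D. F x0 z) z) < e"
        using X0(3)[THEN bspec[of _ _ x], THEN bspec[of _ _ z]] that K(2,3) by auto
    qed
    then show "\<exists>T. open T \<and> x0 \<in> T \<and> T \<subseteq> {x. (\<lambda>z\<in>D. F x z) \<in> U}"
      using X0 by blast
  qed
  then show "(\<lambda>x. \<lambda>z\<in>D. F x z) -` U \<inter> space borel \<in> sets borel"
    by (simp add: vimage_def)
qed

section \<open>Locally uniform convergence in probability\<close>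

text \<open>The bad events need not be measurable; \<open>A n\<close> is a measurable set containing them.\<close>
definition uniform_limit_in_prob ::
  "(nat \<Rightarrow> 'a measure) \<Rightarrow> (nat \<Rightarrow> 'a \<Rightarrow> complex \<Rightarrow> complex) \<Rightarrow> (complex \<Rightarrow> complex) \<Rightarrow> complex set \<Rightarrow> bool" where
  "uniform_limit_in_prob M X f K \<longleftrightarrow> (\<forall>e>0. \<exists>A. (\<forall>n. A n \<in> sets (M n)) \<and>
     (\<lambda>n. measure (M n) (A n)) \<longlonglongrightarrow> 0 \<and>
     (\<forall>n. \<forall>\<omega>\<in>space (M n) - A n. \<forall>z\<in>K. dist (X n \<omega> z) (f z) < e))"

lemma uniform_limit_in_probE:
  assumes "uniform_limit_in_prob M X f K" "e > 0"
  obtains A where "\<And>n. A n \<in> sets (M n)" "(\<lambda>n. measure (M n) (A n)) \<longlonglongrightarrow> 0"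
    "\<And>n \<omega> z. \<omega> \<in> space (M n) - A n \<Longrightarrow> z \<in> K \<Longrightarrow> dist (X n \<omega> z) (f z) < e"
proof -
  obtain A where A: "(\<forall>n. A n \<in> sets (M n)) \<and> (\<lambda>n. measure (M n) (A n)) \<longlonglongrightarrow> 0 \<and>
     (\<forall>n. \<forall>\<omega>\<in>space (M n) - A n. \<forall>z\<in>K. dist (X n \<omega> z) (f z) < e)"
    using assms(1)[unfolded uniform_limit_in_prob_def, rule_format, OF assms(2)] by (rule exE)
  show ?thesis
  proof (rule that[of A])
    show "A n \<in> sets (M n)" for n using A by blast
    show "(\<lambda>n. measure (M n) (A n)) \<longlonglongrightarrow> 0" using A by blast
    show "dist (X n \<omega> z) (f z) < e" if "\<omega> \<in> space (M n) - A n" "z \<in> K" for n \<omega> z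
      using A that by blast
  qed
qed

lemma uniform_limit_in_probI:
  assumes "\<And>e. e > 0 \<Longrightarrow> \<exists>A. (\<forall>n. A n \<in> sets (M n)) \<and> (\<lambda>n. measure (M n) (A n)) \<longlonglongrightarrow> 0 \<and>
     (\<forall>n. \<forall>\<omega>\<in>space (M n) - A n. \<forall>z\<in>K. dist (X n \<omega> z) (f z) < e)"
  shows "uniform_limit_in_prob M X f K"
  using assms by (simp add: uniform_limit_in_prob_def)

lemma uniform_limit_in_prob_subset:
  assumes K: "uniform_limit_in_prob M X f K" and L: "L \<subseteq> K"
  shows "uniform_limit_in_prob M X f L"
proof (rule uniform_limit_in_probI)
  fix e :: real assume e: "e > 0"
  show "\<exists>A. (\<forall>n. A n \<in> sets (M n)) \<and> (\<lambda>n. measure (M n) (A n)) \<longlonglongrightarrow> 0 \<and>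
     (\<forall>n. \<forall>\<omega>\<in>space (M n) - A n. \<forall>z\<in>L. dist (X n \<omega> z) (f z) < e)"
    by (rule uniform_limit_in_probE[OF K e]) (use L in blast)
qed

lemma uniform_limit_in_prob_cong:
  assumes "uniform_limit_in_prob M X f K"
    and "\<And>n \<omega> z. z \<in> K \<Longrightarrow> X n \<omega> z = Y n \<omega> z" "\<And>z. z \<in> K \<Longrightarrow> f z = g z"
  shows "uniform_limit_in_prob M Y g K"
proof (rule uniform_limit_in_probI)
  fix e :: real assume e: "e > 0"
  obtain A where "\<And>n. A n \<in> sets (M n)" "(\<lambda>n. measure (M n) (A n)) \<longlonglongrightarrow> 0"
    "\<And>n \<omega> z. \<omega> \<in> space (M n) - A n \<Longrightarrow> z \<in> K \<Longrightarrow> dist (X n \<omega> z) (f z) < e"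
    by (rule uniform_limit_in_probE[OF assms(1) e]) blast
  then show "\<exists>A. (\<forall>n. A n \<in> sets (M n)) \<and> (\<lambda>n. measure (M n) (A n)) \<longlonglongrightarrow> 0 \<and>
     (\<forall>n. \<forall>\<omega>\<in>space (M n) - A n. \<forall>z\<in>K. dist (Y n \<omega> z) (g z) < e)"
    using assms(2,3) by (intro exI[of _ A]) auto
qed

lemma uniform_limit_in_prob_Un:
  assumes P: "\<And>n. prob_space (M n)"
    and K: "uniform_limit_in_prob M X f K" and L: "uniform_limit_in_prob M X f L"
  shows "uniform_limit_in_prob M X f (K \<union> L)"
  unfolding uniform_limit_in_prob_def
proof (intro allI impI)
  fix e :: real assume e: "e > 0"
  obtain A where A: "\<And>n. A n \<in> sets (M n)" "(\<lambda>n. measure (M n) (A n)) \<longlonglongrightarrow> 0"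
    "\<And>n \<omega> z. \<omega> \<in> space (M n) - A n \<Longrightarrow> z \<in> K \<Longrightarrow> dist (X n \<omega> z) (f z) < e"
    by (rule uniform_limit_in_probE[OF K e]) blast
  obtain B where B: "\<And>n. B n \<in> sets (M n)" "(\<lambda>n. measure (M n) (B n)) \<longlonglongrightarrow> 0"
    "\<And>n \<omega> z. \<omega> \<in> space (M n) - B n \<Longrightarrow> z \<in> L \<Longrightarrow> dist (X n \<omega> z) (f z) < e"
    by (rule uniform_limit_in_probE[OF L e]) blast
  have "(\<lambda>n. measure (M n) (A n \<union> B n)) \<longlonglongrightarrow> 0"
  proof (rule tendsto_sandwich[OF _ _ tendsto_const])
    show "\<forall>\<^sub>F n in sequentially. measure (M n) (A n \<union> B n) \<le> measure (M n) (A n) + measure (M n) (B n)"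
    proof (rule always_eventually, rule allI)
      fix n interpret prob_space "M n" by (rule P)
      show "measure (M n) (A n \<union> B n) \<le> measure (M n) (A n) + measure (M n) (B n)"
        using A(1) B(1) by (intro measure_Un_le) auto
    qed
    show "(\<lambda>n. measure (M n) (A n) + measure (M n) (B n)) \<longlonglongrightarrow> 0"
      using tendsto_add[OF A(2) B(2)] by simp
  qed auto
  then show "\<exists>A. (\<forall>n. A n \<in> sets (M n)) \<and> (\<lambda>n. measure (M n) (A n)) \<longlonglongrightarrow> 0 \<and>
     (\<forall>n. \<forall>\<omega>\<in>space (M n) - A n. \<forall>z\<in>K \<union> L. dist (X n \<omega> z) (f z) < e)"
    using A B by (intro exI[of _ "\<lambda>n. A n \<union> B n"]) (auto intro: sets.Un)
qed

text \<open>A finite subcover suffices, since a union of finitely many bad events with vanishing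
  probabilities still has vanishing probability.\<close>

lemma uniform_limit_in_prob_compact:
  assumes P: "\<And>n. prob_space (M n)"
    and loc: "\<And>z. z \<in> K \<Longrightarrow> \<exists>r>0. uniform_limit_in_prob M X f (ball z r)"
    and K: "compact K"
  shows "uniform_limit_in_prob M X f K"
proof -
  obtain r where r: "\<And>z. z \<in> K \<Longrightarrow> r z > 0" "\<And>z. z \<in> K \<Longrightarrow> uniform_limit_in_prob M X f (ball z (r z))"
    using loc by metis
  obtain C where C: "C \<subseteq> K" "finite C" "K \<subseteq> (\<Union>z\<in>C. ball z (r z))"
    by (rule compactE_image[OF K, of K "\<lambda>z. ball z (r z)"]) (use r in force)+
  have "uniform_limit_in_prob M X f (\<Union>z\<in>C. ball z (r z))"
    using C(2,1)
  proof (induction C rule: finite_induct)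
    case empty
    show ?case by (auto simp: uniform_limit_in_prob_def intro!: exI[of _ "\<lambda>_. {}"])
  next
    case (insert z C)
    then show ?case using r(2) by (auto intro!: uniform_limit_in_prob_Un[OF P])
  qed
  then show ?thesis using C(3) by (rule uniform_limit_in_prob_subset)
qed

text \<open>A neighbourhood of \<open>f\<close> on which \<phi> varies by less than
  \<open>e / 2\<close> contains all analytic functions close to \<open>f\<close> on a single compact
  set. Outside the bad event \<open>X n\<close> lies in it; on the bad event the error is at most
  \<open>2 * B\<close>, and the probability of that event vanishes.\<close>

lemma converges_in_distribution_analytic_const:
  assumes M: "\<And>n. prob_space (M n)" and P: "prob_space P"
    and X: "\<And>n. X n \<in> M n \<rightarrow>\<^sub>M borel_of_topology (analytic_topology D)"
    and f: "f \<in> analytic_fun D"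
    and lim: "\<And>K. compact K \<Longrightarrow> K \<subseteq> D \<Longrightarrow> uniform_limit_in_prob M X f K"
  shows "converges_in_distribution (analytic_topology D) M X P (\<lambda>_. f)"
  unfolding converges_in_distribution_def
proof (intro conjI allI impI)
  let ?T = "analytic_topology D"
  show "X n \<in> M n \<rightarrow>\<^sub>M borel_of_topology ?T" for n by (rule X)
  show "(\<lambda>_. f) \<in> P \<rightarrow>\<^sub>M borel_of_topology ?T"
    using f by (simp add: space_borel_of_topology topspace_analytic_topology)
  fix \<phi> assume "continuous_map ?T euclideanreal \<phi> \<and> bounded (\<phi> ` topspace ?T)"
  then have \<phi>: "continuous_map ?T euclideanreal \<phi>" and "bounded (\<phi> ` topspace ?T)" by auto
  then obtain B where B: "\<And>g. g \<in> analytic_fun D \<Longrightarrow> \<bar>\<phi> g\<bar> \<le> B"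
    unfolding bounded_iff by (auto simp: topspace_analytic_topology)
  have B0: "B \<ge> 0" using B[OF f] by linarith
  interpret P: prob_space P by (rule P)
  have "(\<lambda>n. \<integral>\<omega>. \<phi> (X n \<omega>) \<partial>M n) \<longlonglongrightarrow> \<phi> f"
  proof (rule LIMSEQ_I)
    fix e :: real assume e: "e > 0"
    let ?U = "{g \<in> topspace ?T. \<phi> g \<in> ball (\<phi> f) (e / 2)}"
    have U: "openin ?T ?U"
      by (rule openin_continuous_map_preimage[OF \<phi>]) simp
    have fU: "f \<in> ?U"
      using f e by (simp add: topspace_analytic_topology)
    have "\<forall>f\<in>?U. \<exists>K r. compact K \<and> K \<subseteq> D \<and> 0 < (r::real) \<and>
        (\<forall>g\<in>analytic_fun D. (\<forall>z\<in>K. dist (g z) (f z) < r) \<longrightarrow> g \<in> ?U)"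
      using U unfolding openin_analytic_topology analytic_open_def by (rule conjunct2)
    from bspec[OF this fU] obtain K r where K: "compact K" "K \<subseteq> D" "0 < (r::real)"
      "\<forall>g\<in>analytic_fun D. (\<forall>z\<in>K. dist (g z) (f z) < r) \<longrightarrow> g \<in> ?U"
      by (elim exE conjE)
    obtain A where A: "\<And>n. A n \<in> sets (M n)" "(\<lambda>n. measure (M n) (A n)) \<longlonglongrightarrow> 0"
      "\<And>n \<omega> z. \<omega> \<in> space (M n) - A n \<Longrightarrow> z \<in> K \<Longrightarrow> dist (X n \<omega> z) (f z) < r"
      by (rule uniform_limit_in_probE[OF lim[OF K(1,2)] K(3)]) blast
    have bound: "\<bar>(\<integral>\<omega>. \<phi> (X n \<omega>) \<partial>M n) - \<phi> f\<bar> \<le> e / 2 + 2 * B * measure (M n) (A n)" for n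
    proof -
      interpret prob_space "M n" by (rule M)
      have XD: "X n \<omega> \<in> analytic_fun D" if "\<omega> \<in> space (M n)" for \<omega>
        using measurable_space[OF X that] by (simp add: space_borel_of_topology topspace_analytic_topology)
      have m[measurable]: "(\<lambda>\<omega>. \<phi> (X n \<omega>)) \<in> borel_measurable (M n)"
        by (rule measurable_compose[OF X continuous_map_borel_measurable[OF \<phi>]])
      have i: "integrable (M n) (\<lambda>\<omega>. \<phi> (X n \<omega>))"
        by (rule integrable_const_bound[of _ B]) (use B XD in \<open>auto intro!: AE_I2\<close>)
      have iA: "integrable (M n) (indicator (A n) :: _ \<Rightarrow> real)"
        using A(1) by (simp add: integrable_indicator_iff less_top[symmetric])
      have "(\<integral>\<omega>. \<phi> (X n \<omega>) \<partial>M n) - \<phi> f = (\<integral>\<omega>. \<phi> (X n \<omega>) - \<phi> f \<partial>M n)"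
        using i by (simp add: prob_space)
      also have "\<bar>\<dots>\<bar> \<le> (\<integral>\<omega>. \<bar>\<phi> (X n \<omega>) - \<phi> f\<bar> \<partial>M n)"
        by (rule integral_abs_bound)
      also have "\<dots> \<le> (\<integral>\<omega>. e / 2 + 2 * B * indicator (A n) \<omega> \<partial>M n)"
      proof (rule integral_mono)
        show "integrable (M n) (\<lambda>\<omega>. \<bar>\<phi> (X n \<omega>) - \<phi> f\<bar>)" using i by simp
        show "integrable (M n) (\<lambda>\<omega>. e / 2 + 2 * B * indicator (A n) \<omega>)" using iA by simp
        fix \<omega> assume \<omega>: "\<omega> \<in> space (M n)"
        show "\<bar>\<phi> (X n \<omega>) - \<phi> f\<bar> \<le> e / 2 + 2 * B * indicator (A n) \<omega>"
        proof (cases "\<omega> \<in> A n")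
          case True
          then show ?thesis using B[OF XD[OF \<omega>]] B[OF f] e by simp
        next
          case False
          then have "\<forall>z\<in>K. dist (X n \<omega> z) (f z) < r"
            using A(3)[of \<omega> n] \<omega> by blast
          then have "X n \<omega> \<in> ?U"
            using K(4) XD[OF \<omega>] by blast
          then show ?thesis using False by (simp add: dist_real_def abs_minus_commute)
        qed
      qed
      also have "\<dots> = e / 2 + 2 * B * measure (M n) (A n)"
        using iA A(1) by (simp add: prob_space)
      finally show ?thesis .
    qed
    have "(\<lambda>n. 2 * B * measure (M n) (A n)) \<longlonglongrightarrow> 2 * B * 0"
      by (intro tendsto_intros A(2))
    then have "\<forall>\<^sub>F n in sequentially. 2 * B * measure (M n) (A n) < e / 2"
      using e by (intro order_tendstoD) auto
    then have "\<forall>\<^sub>F n in sequentially. norm ((\<integral>\<omega>. \<phi> (X n \<omega>) \<partial>M n) - \<phi> f) < e"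
    proof (rule eventually_mono)
      fix n assume "2 * B * measure (M n) (A n) < e / 2"
      then show "norm ((\<integral>\<omega>. \<phi> (X n \<omega>) \<partial>M n) - \<phi> f) < e"
        using bound[of n] by simp
    qed
    then show "\<exists>no. \<forall>n\<ge>no. norm ((\<integral>\<omega>. \<phi> (X n \<omega>) \<partial>M n) - \<phi> f) < e"
      by (simp add: eventually_sequentially)
  qed
  then show "(\<lambda>n. \<integral>\<omega>. \<phi> (X n \<omega>) \<partial>M n) \<longlonglongrightarrow> (\<integral>\<omega>. \<phi> f \<partial>P)"
    by (simp add: P.prob_space)
qed

section \<open>From mean bounds on a circle to uniform bounds on a disc\<close>

text \<open>Cauchy's formula: for \<open>w\<close> within half the radius the kernel is at most
  \<open>2 / r\<close> in modulus, whence the factor 2. The mean is written as a nonnegative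
  integral so that it can be exchanged with the expectation.\<close>

lemma norm_le_circle_mean:
  assumes f: "f holomorphic_on cball z r" and r: "r > 0" and w: "w \<in> cball z (r / 2)"
  shows "ennreal (norm (f w)) \<le> 2 * (\<integral>\<^sup>+t. ennreal (norm (f (circlepath z r t))) * indicator {0..1} t \<partial>lborel)"
proof -
  let ?g = "circlepath z r"
  have "((\<lambda>u. f u / (u - w)) has_contour_integral (2 * of_real pi * \<i> * f w)) ?g"
    using w r by (intro Cauchy_integral_circlepath_simple f) (auto simp: dist_norm norm_minus_commute)
  then have hi: "((\<lambda>t. f (?g t) / (?g t - w) * vector_derivative ?g (at t within {0..1}))
      has_integral (2 * of_real pi * \<i> * f w)) {0..1}"
    by (simp add: has_contour_integral_def)
  have gs: "?g t \<in> sphere z r" for t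
    using r by (simp add: circlepath dist_norm norm_mult)
  have cf: "continuous_on {0..1} (\<lambda>t. f (?g t))"
  proof (rule continuous_on_compose2[OF holomorphic_on_imp_continuous_on[OF f]])
    show "continuous_on {0..1} ?g" using path_circlepath by (simp add: path_def)
  qed (use gs sphere_cball in blast)
  then have cn: "continuous_on {0..1} (\<lambda>t. norm (f (?g t)))"
    by (rule continuous_on_norm)
  have "norm (2 * of_real pi * \<i> * f w) \<le> integral {0..1} (\<lambda>t. 4 * pi * norm (f (?g t)))"
    unfolding integral_unique[OF hi, symmetric]
  proof (rule integral_norm_bound_integral)
    show "(\<lambda>t. 4 * pi * norm (f (?g t))) integrable_on {0..1}"
      using cf by (intro integrable_continuous_real continuous_intros)
    fix t :: real assume t: "t \<in> {0..1}"
    have "r / 2 \<le> norm (?g t - w)"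
      using gs[of t] w norm_triangle_ineq2[of "?g t - z" "w - z"]
      by (simp add: dist_norm norm_minus_commute)
    then have "norm (f (?g t) / (?g t - w)) \<le> norm (f (?g t)) / (r / 2)"
      unfolding norm_divide using r by (intro divide_left_mono mult_pos_pos) auto
    moreover have "norm (vector_derivative ?g (at t within {0..1})) = 2 * pi * r"
      using t r by (simp add: vector_derivative_circlepath01 norm_mult)
    ultimately have "norm (f (?g t) / (?g t - w) * vector_derivative ?g (at t within {0..1}))
      \<le> norm (f (?g t)) / (r / 2) * (2 * pi * r)"
      unfolding norm_mult using r by (intro mult_mono) auto
    then show "norm (f (?g t) / (?g t - w) * vector_derivative ?g (at t within {0..1})) \<le> 4 * pi * norm (f (?g t))"
      using r by (simp add: field_simps)
  qed (use hi in blast)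
  then have "norm (f w) \<le> 2 * integral {0..1} (\<lambda>t. norm (f (?g t)))"
    by (simp add: norm_mult)
  then have "ennreal (norm (f w)) \<le> ennreal (2 * integral {0..1} (\<lambda>t. norm (f (?g t))))"
    by (rule ennreal_leI)
  also have "\<dots> = 2 * ennreal (integral {0..1} (\<lambda>t. norm (f (?g t))))"
    by (simp add: ennreal_mult' integral_nonneg[OF integrable_continuous_real[OF cn]])
  also have "ennreal (integral {0..1} (\<lambda>t. norm (f (?g t))))
    = (\<integral>\<^sup>+t. ennreal (norm (f (?g t))) * indicator {0..1} t \<partial>lborel)"
    by (rule nn_integral_has_integral_lebesgue'[symmetric])
       (use integrable_integral[OF integrable_continuous_real[OF cn]] in auto)
  finally show ?thesis .
qed

text \<open>The single random variable \<open>H n\<close>, the mean over the circle, dominates the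
  error on the whole smaller disc. Its expectation is controlled by Tonelli's theorem from the first
  moments at the points of the circle, and Markov's inequality finishes the argument.\<close>

lemma uniform_limit_in_prob_circle:
  fixes X :: "nat \<Rightarrow> 'a \<Rightarrow> complex \<Rightarrow> complex"
  assumes M: "\<And>n. prob_space (M n)" and r: "r > 0"
    and X: "\<And>n \<omega>. X n \<omega> holomorphic_on cball z r" and f: "f holomorphic_on cball z r"
    and meas: "\<And>n. (\<lambda>(\<omega>, t). X n \<omega> (circlepath z r t) - f (circlepath z r t)) \<in> borel_measurable (M n \<Otimes>\<^sub>M lborel)"
    and lim: "\<And>e. e > 0 \<Longrightarrow> \<forall>\<^sub>F n in sequentially. \<forall>u\<in>sphere z r.
        (\<integral>\<^sup>+\<omega>. ennreal (norm (X n \<omega> u - f u)) \<partial>M n) \<le> ennreal e"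
  shows "uniform_limit_in_prob M X f (ball z (r / 2))"
  unfolding uniform_limit_in_prob_def
proof (intro allI impI)
  fix e :: real assume e: "e > 0"
  let ?h = "\<lambda>n \<omega> t. ennreal (norm (X n \<omega> (circlepath z r t) - f (circlepath z r t))) * indicator {0..1} t"
  define H where "H n \<omega> = (\<integral>\<^sup>+t. ?h n \<omega> t \<partial>lborel)" for n \<omega>
  \<comment> \<open>The bad event is expressed through \<open>H n\<close> instead of a supremum over
    the disc, which makes it measurable.\<close>
  define A where "A n = {\<omega> \<in> space (M n). ennreal e \<le> 2 * H n \<omega>}" for n
  have hm[measurable]: "(\<lambda>(\<omega>, t). ?h n \<omega> t) \<in> borel_measurable (M n \<Otimes>\<^sub>M lborel)" for n
    using meas[of n] unfolding case_prod_beta by measurable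
  have Hm[measurable]: "H n \<in> borel_measurable (M n)" for n
    unfolding H_def by (rule lborel.borel_measurable_nn_integral) (use hm in simp)
  have Am: "A n \<in> sets (M n)" for n unfolding A_def by measurable
  have "(\<lambda>n. measure (M n) (A n)) \<longlonglongrightarrow> 0"
  proof (rule LIMSEQ_I)
    fix \<delta> :: real assume \<delta>: "\<delta> > 0"
    have "\<forall>\<^sub>F n in sequentially. measure (M n) (A n) < \<delta>"
      using lim[of "e * \<delta> / 4"]
    proof (rule eventually_mono)
      show "0 < e * \<delta> / 4" using e \<delta> by simp
      fix n assume n: "\<forall>u\<in>sphere z r. (\<integral>\<^sup>+\<omega>. ennreal (norm (X n \<omega> u - f u)) \<partial>M n) \<le> ennreal (e * \<delta> / 4)"
      interpret prob_space "M n" by (rule M)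
      interpret pair_sigma_finite "M n" lborel ..
      have gs: "circlepath z r t \<in> sphere z r" for t
        using r by (simp add: circlepath dist_norm norm_mult)
      have [measurable]: "(\<lambda>\<omega>. X n \<omega> (circlepath z r t) - f (circlepath z r t)) \<in> borel_measurable (M n)" for t
        using measurable_compose[OF measurable_Pair2'[of t lborel "M n"] meas[of n]] by simp
      have "(\<integral>\<^sup>+\<omega>. H n \<omega> \<partial>M n) = (\<integral>\<^sup>+t. (\<integral>\<^sup>+\<omega>. ?h n \<omega> t \<partial>M n) \<partial>lborel)"
        unfolding H_def using Fubini'[OF hm] by simp
      also have "\<dots> \<le> (\<integral>\<^sup>+t. ennreal (e * \<delta> / 4) * indicator {0..1::real} t \<partial>lborel)"
      proof (rule nn_integral_mono)
        fix t :: real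
        show "(\<integral>\<^sup>+\<omega>. ?h n \<omega> t \<partial>M n) \<le> ennreal (e * \<delta> / 4) * indicator {0..1} t"
          using bspec[OF n gs[of t]] by (simp add: nn_integral_multc mult_right_mono)
      qed
      also have "\<dots> = ennreal (e * \<delta> / 4)" by (simp add: nn_integral_cmult_indicator)
      finally have EH: "(\<integral>\<^sup>+\<omega>. H n \<omega> \<partial>M n) \<le> ennreal (e * \<delta> / 4)" .
      \<comment> \<open>Markov's inequality at level \<open>e / 2\<close>: the mean bound
        \<open>e * \<delta> / 4\<close> was chosen to give probability at most
        \<open>\<delta> / 2\<close>.\<close>
      have "emeasure (M n) {\<omega> \<in> space (M n). 1 \<le> ennreal (2 / e) * H n \<omega>}
          \<le> ennreal (2 / e) * (\<integral>\<^sup>+\<omega>. H n \<omega> * indicator (space (M n)) \<omega> \<partial>M n)"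
        using nn_integral_Markov_inequality[of "H n" "space (M n)" "M n" "ennreal (2 / e)"] by simp
      also have "(\<integral>\<^sup>+\<omega>. H n \<omega> * indicator (space (M n)) \<omega> \<partial>M n) = (\<integral>\<^sup>+\<omega>. H n \<omega> \<partial>M n)"
        by (intro nn_integral_cong) simp
      also have "ennreal (2 / e) * \<dots> \<le> ennreal (2 / e) * ennreal (e * \<delta> / 4)"
        by (intro mult_left_mono EH) simp
      also have "\<dots> = ennreal (\<delta> / 2)" using e \<delta> by (simp flip: ennreal_mult)
      finally have "emeasure (M n) {\<omega> \<in> space (M n). 1 \<le> ennreal (2 / e) * H n \<omega>} \<le> ennreal (\<delta> / 2)" .
      moreover have "A n \<subseteq> {\<omega> \<in> space (M n). 1 \<le> ennreal (2 / e) * H n \<omega>}"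
      proof
        fix \<omega> assume "\<omega> \<in> A n"
        then have \<omega>: "\<omega> \<in> space (M n)" "ennreal e \<le> 2 * H n \<omega>" by (auto simp: A_def)
        have "1 = ennreal (1 / e) * ennreal e" using e by (simp flip: ennreal_mult)
        also have "\<dots> \<le> ennreal (1 / e) * (2 * H n \<omega>)" by (intro mult_left_mono \<omega>) simp
        also have "\<dots> = ennreal (1 / e) * ennreal 2 * H n \<omega>" by (simp add: mult.assoc)
        also have "\<dots> = ennreal (2 / e) * H n \<omega>" using e by (subst ennreal_mult[symmetric]) auto
        finally show "\<omega> \<in> {\<omega> \<in> space (M n). 1 \<le> ennreal (2 / e) * H n \<omega>}" using \<omega> by simp
      qed
      moreover have "{\<omega> \<in> space (M n). 1 \<le> ennreal (2 / e) * H n \<omega>} \<in> sets (M n)"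
        by measurable
      ultimately have "emeasure (M n) (A n) \<le> ennreal (\<delta> / 2)"
        by (meson emeasure_mono order_trans)
      then have "measure (M n) (A n) \<le> \<delta> / 2"
        using \<delta> by (simp add: emeasure_eq_measure)
      then show "measure (M n) (A n) < \<delta>" using \<delta> by simp
    qed
    then show "\<exists>no. \<forall>n\<ge>no. norm (measure (M n) (A n) - 0) < \<delta>"
      by (simp add: eventually_sequentially)
  qed
  moreover have "dist (X n \<omega> w) (f w) < e" if \<omega>: "\<omega> \<in> space (M n) - A n" and w: "w \<in> ball z (r / 2)" for n \<omega> w
  proof -
    have "ennreal (norm (X n \<omega> w - f w)) \<le> 2 * H n \<omega>"
      unfolding H_def using w
      by (intro norm_le_circle_mean[of "\<lambda>u. X n \<omega> u - f u"] holomorphic_on_diff X f r) auto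
    also have "\<dots> < ennreal e" using \<omega> by (auto simp: A_def not_le)
    finally show ?thesis using e by (simp add: dist_norm ennreal_less_iff)
  qed
  ultimately show "\<exists>A. (\<forall>n. A n \<in> sets (M n)) \<and> (\<lambda>n. measure (M n) (A n)) \<longlonglongrightarrow> 0 \<and>
     (\<forall>n. \<forall>\<omega>\<in>space (M n) - A n. \<forall>z\<in>ball z (r / 2). dist (X n \<omega> z) (f z) < e)"
    using Am by blast
qed

section \<open>The exponent\<close>

text \<open>For \<open>2 * \<bar>Re \<beta>\<bar> < s\<close> the complement of
  \<open>grem_F s\<close> gives \<open>p = 2\<close>. Otherwise the complement of
  \<open>grem_G s\<close> yields \<open>\<bar>Re \<beta>\<bar> + \<bar>Im \<beta>\<bar> < s\<close>,
  and the minimiser is used; for real \<beta> it would be the excluded value 1, so a slightly larger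
  \<open>p\<close> is taken.\<close>

lemma grem_E_exponent:
  assumes \<beta>: "\<beta> \<in> grem_E s" and s: "s > 0"
  obtains p where "1 < p" "p \<le> 2" "p * (Re \<beta>)\<^sup>2 + p / (p - 1) * (Im \<beta>)\<^sup>2 < s\<^sup>2"
proof -
  define u v where "u = \<bar>Re \<beta>\<bar>" and "v = \<bar>Im \<beta>\<bar>"
  have uv: "u \<ge> 0" "v \<ge> 0" "(Re \<beta>)\<^sup>2 = u\<^sup>2" "(Im \<beta>)\<^sup>2 = v\<^sup>2" by (auto simp: u_def v_def)
  \<comment> \<open>As \<open>grem_E s\<close> is open, slightly enlarging \<open>\<beta>\<close> makes the weak inequalities strict.\<close>
  have "open (grem_E s)" unfolding grem_E_def by (intro open_Diff) auto
  then have "open ((\<lambda>t::real. of_real t * \<beta>) -` grem_E s)"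
    by (rule open_vimage) (intro continuous_intros)
  \<comment> \<open>This second open set keeps the enlarged point on the same side of the line
    \<open>2 * u = s\<close>, so that the condition from \<open>grem_F s\<close> can still be used
    there.\<close>
  moreover have "open {t::real. 2 * u < s \<longrightarrow> 2 * (t * u) < s}"
    by (intro open_Collect_imp open_Collect_less closed_Collect_const continuous_intros)
  ultimately have "open ((\<lambda>t::real. of_real t * \<beta>) -` grem_E s \<inter> {t. 2 * u < s \<longrightarrow> 2 * (t * u) < s})"
    by (rule open_Int)
  moreover have "1 \<in> (\<lambda>t::real. of_real t * \<beta>) -` grem_E s \<inter> {t. 2 * u < s \<longrightarrow> 2 * (t * u) < s}"
    using \<beta> by simp
  ultimately obtain e where e: "e > 0"
    "cball 1 e \<subseteq> (\<lambda>t::real. of_real t * \<beta>) -` grem_E s \<inter> {t. 2 * u < s \<longrightarrow> 2 * (t * u) < s}"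
    unfolding open_contains_cball by metis
  define t where "t = 1 + e"
  have t: "t > 1" using e by (simp add: t_def)
  have "t \<in> cball 1 e" using e by (simp add: t_def dist_norm)
  then have tE: "of_real t * \<beta> \<in> grem_E s" and tu: "2 * u < s \<Longrightarrow> 2 * (t * u) < s"
    using e(2) by auto
  have "of_real t * \<beta> \<notin> grem_G s \<union> grem_F s"
    using tE closure_subset[of "grem_G s \<union> grem_F s"] by (auto simp: grem_E_def)
  then have G: "2 * (t * u) > s \<Longrightarrow> t * u + t * v \<le> s"
    and F: "2 * (t * u) < s \<Longrightarrow> 2 * ((t * u)\<^sup>2 + (t * v)\<^sup>2) \<le> s\<^sup>2"
    using t by (auto simp: grem_G_def grem_F_def u_def v_def abs_mult power_mult_distrib)
  show ?thesis
  proof (cases "2 * u < s")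
    case True
    have le: "t\<^sup>2 * (2 * (u\<^sup>2 + v\<^sup>2)) \<le> s\<^sup>2"
      using F[OF tu[OF True]] by (simp add: power_mult_distrib algebra_simps)
    have "2 * (u\<^sup>2 + v\<^sup>2) < s\<^sup>2"
    proof (cases "u\<^sup>2 + v\<^sup>2 = 0")
      case False
      then have "2 * (u\<^sup>2 + v\<^sup>2) > 0" by (smt (verit) zero_le_power2)
      then have "1 * (2 * (u\<^sup>2 + v\<^sup>2)) < t\<^sup>2 * (2 * (u\<^sup>2 + v\<^sup>2))"
        using t by (intro mult_strict_right_mono one_less_power) auto
      then show ?thesis using le by simp
    qed (use s in simp)
    then show ?thesis by (intro that[of 2]) (auto simp: uv)
  next
    case False
    then have u: "u > 0" "2 * u \<ge> s" using s by auto
    \<comment> \<open>Enlarging also handles the line \<open>2 * u = s\<close> itself: the scaled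
      point satisfies the strict inequality that the condition from \<open>grem_G s\<close> asks
      for.\<close>
    have "u * 1 < u * t" using u t by (intro mult_strict_left_mono) auto
    then have "2 * (t * u) > s" using u(2) by (simp add: mult.commute[of t])
    then have "t * (u + v) \<le> s" using G by (simp add: algebra_simps)
    moreover have "1 * (u + v) < t * (u + v)"
      using t u uv by (intro mult_strict_right_mono) auto
    ultimately have sum: "u + v < s" by simp
    show ?thesis
    proof (cases "v = 0")
      case True
      have us: "u\<^sup>2 < s\<^sup>2" using sum True u by (intro power_strict_mono) auto
      \<comment> \<open>With \<open>v = 0\<close> every \<open>p\<close> strictly between 1 and
        \<open>q\<close> satisfies the inequality; the midpoint is taken and capped at 2.\<close>
      define q where "q = s\<^sup>2 / u\<^sup>2"
      define p where "p = min 2 ((1 + q) / 2)"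
      have q: "q > 1" using us u by (simp add: q_def)
      have "p < q" using q by (simp add: p_def min_def)
      then have "p * u\<^sup>2 < s\<^sup>2" using u by (simp add: q_def pos_less_divide_eq)
      then show ?thesis using q True by (intro that[of p]) (auto simp: uv p_def)
    next
      case False
      then have v: "v > 0" using uv by simp
      \<comment> \<open>The minimiser of the left-hand side over \<open>p > 1\<close>. It is at most
        2 because \<open>u + v < s \<le> 2 * u\<close> forces \<open>v < u\<close>.\<close>
      have p: "1 < 1 + v / u" "1 + v / u \<le> 2" using u v sum by (auto simp: field_simps)
      have "(1 + v / u) * u\<^sup>2 + (1 + v / u) / ((1 + v / u) - 1) * v\<^sup>2 = (u + v)\<^sup>2"
        using u v by (simp add: field_simps power2_eq_square)
      also have "\<dots> < s\<^sup>2" using sum u v by (intro power_strict_mono) auto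
      finally show ?thesis using p by (intro that[of "1 + v / u"]) (auto simp: uv)
    qed
  qed
qed

text \<open>Since \<open>a * s\<^sup>2 \<le> 2 * ln \<alpha>\<close>, the growth of the moment is at
  most \<open>(\<alpha> ^ n) powr (p - 1)\<close> times a power with rate governed by \<delta>. The
  first factor is compensated by \<open>N powr (1 - p)\<close> up to the ratio
  \<open>N / \<alpha> ^ n\<close>, which tends to 1 in the application.\<close>

lemma level_factor_le:
  fixes \<alpha> a s p \<delta> :: real
  assumes a: "a > 0" and \<alpha>: "\<alpha> > 1" and s: "0 \<le> s" "s \<le> sqrt (2 * ln \<alpha> / a)" and p: "1 < p"
    and \<beta>: "p * (Re \<beta>)\<^sup>2 + p / (p - 1) * (Im \<beta>)\<^sup>2 \<le> s\<^sup>2 - \<delta>" and N: "N > 0"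
  shows "N powr (1 - p) * wick_moment p \<beta> (sqrt (real n) * sqrt a)
    \<le> (N / \<alpha> ^ n) powr (1 - p) * exp (- (a * (p - 1) * \<delta> / 2)) ^ n"
proof -
  have "s\<^sup>2 \<le> (sqrt (2 * ln \<alpha> / a))\<^sup>2" using s by (intro power_mono) auto
  also have "\<dots> = 2 * ln \<alpha> / a" using a \<alpha> by simp
  finally have s2: "a * s\<^sup>2 \<le> 2 * ln \<alpha>" using a by (simp add: field_simps)
  have "p * (p - 1) * (Re \<beta>)\<^sup>2 + p * (Im \<beta>)\<^sup>2 = (p - 1) * (p * (Re \<beta>)\<^sup>2 + p / (p - 1) * (Im \<beta>)\<^sup>2)"
    using p by (simp add: field_simps)
  also have "\<dots> \<le> (p - 1) * (s\<^sup>2 - \<delta>)" using p \<beta> by (intro mult_left_mono) auto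
  finally have "n * a / 2 * (p * (p - 1) * (Re \<beta>)\<^sup>2 + p * (Im \<beta>)\<^sup>2) \<le> n * a / 2 * ((p - 1) * (s\<^sup>2 - \<delta>))"
    using a by (intro mult_left_mono) auto
  also have "\<dots> = n * (p - 1) / 2 * (a * s\<^sup>2) + n * (- (a * (p - 1) * \<delta> / 2))"
    by (simp add: field_simps)
  also have "n * (p - 1) / 2 * (a * s\<^sup>2) \<le> n * (p - 1) / 2 * (2 * ln \<alpha>)"
    using p s2 by (intro mult_left_mono) auto
  finally have "wick_moment p \<beta> (sqrt (real n) * sqrt a)
    \<le> exp (n * (p - 1) * ln \<alpha> + n * (- (a * (p - 1) * \<delta> / 2)))"
    using a by (simp add: wick_moment_def power_mult_distrib)
  also have "\<dots> = (\<alpha> ^ n) powr (p - 1) * exp (- (a * (p - 1) * \<delta> / 2)) ^ n"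
  proof -
    have "(\<alpha> ^ n) powr (p - 1) = exp (n * (p - 1) * ln \<alpha>)"
      using \<alpha> by (simp add: powr_def ln_realpow)
    then show ?thesis
      unfolding exp_add exp_of_nat_mult[symmetric] by simp
  qed
  finally have "N powr (1 - p) * wick_moment p \<beta> (sqrt (real n) * sqrt a)
    \<le> N powr (1 - p) * ((\<alpha> ^ n) powr (p - 1) * exp (- (a * (p - 1) * \<delta> / 2)) ^ n)"
    by (intro mult_left_mono) auto
  also have "\<dots> = (N / \<alpha> ^ n) powr (1 - p) * exp (- (a * (p - 1) * \<delta> / 2)) ^ n"
  proof -
    have "(\<alpha> ^ n) powr (1 - p) = inverse ((\<alpha> ^ n) powr (p - 1))"
      using powr_minus[of "\<alpha> ^ n" "p - 1"] by simp
    moreover have "(N / \<alpha> ^ n) powr (1 - p) = N powr (1 - p) / (\<alpha> ^ n) powr (1 - p)"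
      by (rule powr_divide)
    ultimately have "(N / \<alpha> ^ n) powr (1 - p) = N powr (1 - p) * (\<alpha> ^ n) powr (p - 1)"
      by (simp only: divide_inverse inverse_inverse_eq)
    then show ?thesis by simp
  qed
  finally show ?thesis .
qed

lemma level_factor_bound_tendsto_0:
  fixes N :: "nat \<Rightarrow> nat \<Rightarrow> nat" and \<alpha> a :: "nat \<Rightarrow> real" and p \<delta> :: real
  assumes a: "\<And>j. j \<in> {1..d} \<Longrightarrow> a j > 0" and p: "1 < p" and \<delta>: "\<delta> > 0"
    and lim: "\<And>j. j \<in> {1..d} \<Longrightarrow> (\<lambda>n. real (N n j) / \<alpha> j ^ n) \<longlonglongrightarrow> 1"
  shows "(\<lambda>n. \<Sum>m=1..d. \<Prod>i=1..m. (real (N n i) / \<alpha> i ^ n) powr (1 - p) * exp (- (a i * (p - 1) * \<delta> / 2)) ^ n)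
    \<longlonglongrightarrow> 0"
proof -
  have "(\<lambda>n. (real (N n i) / \<alpha> i ^ n) powr (1 - p) * exp (- (a i * (p - 1) * \<delta> / 2)) ^ n) \<longlonglongrightarrow> 1 powr (1 - p) * 0"
    if "i \<in> {1..d}" for i
    using a[OF that] p \<delta> by (intro tendsto_mult tendsto_powr lim[OF that] tendsto_const LIMSEQ_power_zero) auto
  then have "(\<lambda>n. \<Sum>m=1..d. \<Prod>i=1..m. (real (N n i) / \<alpha> i ^ n) powr (1 - p) * exp (- (a i * (p - 1) * \<delta> / 2)) ^ n)
    \<longlonglongrightarrow> (\<Sum>m=1..d. \<Prod>i=1..m. 0)"
    by (intro tendsto_sum tendsto_prod) auto
  \<comment> \<open>Each \<open>m\<close> is at least 1, so every product has a factor 0.\<close>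
  also have "(\<Sum>m=1..d. \<Prod>i=1..m. (0::real)) = 0"
    by (intro sum.neutral) auto
  finally show ?thesis .
qed

section \<open>The partition function\<close>

lemma (in gaussian_tree) grem_partition_eq:
  fixes a :: "nat \<Rightarrow> real" and \<beta> :: complex
  defines "b \<equiv> \<lambda>i. sqrt (real n) * sqrt (a i)"
  shows "grem_partition d a N n X \<beta> \<omega>
    = exp (\<beta>\<^sup>2 * of_real (\<Sum>i=1..d. (b i)\<^sup>2) / 2)
      * (\<Sum>\<epsilon>\<in>grem_level N n d. branch_weight \<beta> b d \<epsilon> (\<lambda>\<delta>. X \<delta> \<omega>))"
proof -
  have "exp (\<beta> * of_real (sqrt (real n) * grem_energy d a X \<epsilon> \<omega>))
    = exp (\<beta>\<^sup>2 * of_real (\<Sum>i=1..d. (b i)\<^sup>2) / 2) * branch_weight \<beta> b d \<epsilon> (\<lambda>\<delta>. X \<delta> \<omega>)" for \<epsilon>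
  proof -
    have "(\<Sum>i=1..d. \<beta> * of_real (b i * X (take i \<epsilon>) \<omega>) - \<beta>\<^sup>2 * of_real ((b i)\<^sup>2) / 2)
      = \<beta> * of_real (sqrt (real n) * grem_energy d a X \<epsilon> \<omega>) - \<beta>\<^sup>2 * of_real (\<Sum>i=1..d. (b i)\<^sup>2) / 2"
      by (simp only: sum_subtractf grem_energy_def b_def of_real_sum sum_distrib_left sum_divide_distrib mult.assoc)
    then show ?thesis
      unfolding branch_weight_def wick_exp_def exp_sum[OF finite_atLeastAtMost, symmetric]
      by (simp add: exp_diff)
  qed
  then show ?thesis by (simp add: grem_partition_def sum_distrib_left)
qed

text \<open>If some \<open>N n i\<close> is zero, both sides are zero since \<open>x / 0 = 0\<close>.\<close>
lemma (in gaussian_tree) grem_quotient_eq: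
  fixes a :: "nat \<Rightarrow> real" and \<beta> :: complex
  defines "b \<equiv> \<lambda>i. sqrt (real n) * sqrt (a i)"
  shows "grem_partition d a N n X \<beta> \<omega> / (\<integral>\<omega>'. grem_partition d a N n X \<beta> \<omega>' \<partial>M)
    = level_weight \<beta> b N n d (\<lambda>\<delta>. X \<delta> \<omega>)"
proof -
  have "(\<integral>\<omega>'. grem_partition d a N n X \<beta> \<omega>' \<partial>M)
    = exp (\<beta>\<^sup>2 * of_real (\<Sum>i=1..d. (b i)\<^sup>2) / 2) * (\<Sum>\<epsilon>\<in>grem_level N n d. 1)"
    unfolding grem_partition_eq
    using branch_weight_moments(1,2)[of _ d d \<beta> b] by (simp add: b_def)
  also have "(\<Sum>\<epsilon>\<in>grem_level N n d. 1) = (of_nat (\<Prod>i=1..d. N n i) :: complex)"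
    using card_grem_level[of N n d] by simp
  finally show ?thesis
    unfolding grem_partition_eq level_weight_def by (simp add: b_def)
qed

section \<open>Holomorphy, continuity and measurability of the normalised weight\<close>

lemma holomorphic_level_weight: "(\<lambda>\<beta>. level_weight \<beta> b N n j x) holomorphic_on S"
  unfolding level_weight_def branch_weight_def wick_exp_def divide_inverse
  by (intro holomorphic_intros)

lemma continuous_on_level_weight:
  fixes f :: "'x::topological_space \<Rightarrow> complex" and g :: "'x \<Rightarrow> nat list \<Rightarrow> real"
  assumes "continuous_on S f" "\<And>\<delta>. continuous_on S (\<lambda>x. g x \<delta>)"
  shows "continuous_on S (\<lambda>x. level_weight (f x) b N n j (g x))"
  unfolding level_weight_def branch_weight_def wick_exp_def divide_inverse
  by (intro continuous_intros assms)

text \<open>Only variables at nodes are known to be measurable; setting the others to 0 gives a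
  random element of the whole product space \<open>nat list \<Rightarrow> real\<close> with its
  product topology. On that space \<open>level_weight\<close> is continuous, and its value is
  unchanged.\<close>

lemma (in gaussian_tree) measurable_tree_extension:
  "(\<lambda>\<omega> \<delta>. if \<delta> \<in> grem_nodes d N n then X \<delta> \<omega> else 0) \<in> borel_measurable M"
proof (rule measurable_coordinatewise_then_product)
  fix \<delta>
  show "(\<lambda>\<omega>. if \<delta> \<in> grem_nodes d N n then X \<delta> \<omega> else 0) \<in> borel_measurable M"
    using distributed_measurable[OF normal, of \<delta>] by (cases "\<delta> \<in> grem_nodes d N n") auto
qed

lemma (in gaussian_tree) level_weight_tree_extension:
  "level_weight \<beta> b N n d (\<lambda>\<delta>. X \<delta> \<omega>)
    = level_weight \<beta> b N n d (\<lambda>\<delta>. if \<delta> \<in> grem_nodes d N n then X \<delta> \<omega> else 0)"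
  by (rule level_weight_cong) simp

text \<open>Joint measurability in \<omega> and the circle parameter, as Tonelli's theorem requires:
  a continuous function of node values and parameter is composed with a measurable map.\<close>

lemma (in gaussian_tree) measurable_level_weight_path:
  assumes g: "continuous_on UNIV (g :: real \<Rightarrow> complex)"
  shows "(\<lambda>(\<omega>, t). level_weight (g t) b N n d (\<lambda>\<delta>. X \<delta> \<omega>)) \<in> borel_measurable (M \<Otimes>\<^sub>M lborel)"
proof -
  have "continuous_on UNIV (\<lambda>q :: (nat list \<Rightarrow> real) \<times> real. level_weight (g (snd q)) b N n d (fst q))"
  proof (rule continuous_on_level_weight)
    show "continuous_on UNIV (\<lambda>q :: (nat list \<Rightarrow> real) \<times> real. g (snd q))"
      by (rule continuous_on_compose2[OF g]) (auto intro: continuous_intros)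
    show "continuous_on UNIV (\<lambda>q :: (nat list \<Rightarrow> real) \<times> real. fst q \<delta>)" for \<delta>
      by (rule continuous_on_compose2[OF continuous_on_product_coordinates]) (auto intro: continuous_intros)
  qed
  then have 1: "(\<lambda>q :: (nat list \<Rightarrow> real) \<times> real. level_weight (g (snd q)) b N n d (fst q))
      \<in> borel_measurable (borel \<Otimes>\<^sub>M borel)"
    unfolding borel_prod by (rule borel_measurable_continuous_onI)
  have 2: "(\<lambda>q. (\<lambda>\<delta>. if \<delta> \<in> grem_nodes d N n then X \<delta> (fst q) else 0, snd q))
      \<in> M \<Otimes>\<^sub>M lborel \<rightarrow>\<^sub>M borel \<Otimes>\<^sub>M (borel :: real measure)"
    by (intro measurable_Pair measurable_compose[OF measurable_fst measurable_tree_extension]) simp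
  have "(\<lambda>q. level_weight (g (snd q)) b N n d (\<lambda>\<delta>. if \<delta> \<in> grem_nodes d N n then X \<delta> (fst q) else 0))
      \<in> borel_measurable (M \<Otimes>\<^sub>M lborel)"
    using measurable_compose[OF 2 1] by simp
  then show ?thesis
    unfolding level_weight_tree_extension case_prod_beta .
qed

lemma (in gaussian_tree) measurable_analytic_level_weight:
  "(\<lambda>\<omega>. \<lambda>\<beta>\<in>D. level_weight \<beta> b N n d (\<lambda>\<delta>. X \<delta> \<omega>))
    \<in> M \<rightarrow>\<^sub>M borel_of_topology (analytic_topology D)"
proof -
  have "continuous_on UNIV (\<lambda>q :: (nat list \<Rightarrow> real) \<times> complex. level_weight (snd q) b N n d (fst q))"
  proof (rule continuous_on_level_weight)
    show "continuous_on UNIV (\<lambda>q :: (nat list \<Rightarrow> real) \<times> complex. fst q \<delta>)" for \<delta>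
      by (rule continuous_on_compose2[OF continuous_on_product_coordinates]) (auto intro: continuous_intros)
  qed (intro continuous_intros)
  then have "(\<lambda>x. \<lambda>\<beta>\<in>D. level_weight \<beta> b N n d x) \<in> borel \<rightarrow>\<^sub>M borel_of_topology (analytic_topology D)"
    by (intro measurable_analytic_family holomorphic_level_weight) (simp add: case_prod_beta)
  then show ?thesis
    unfolding level_weight_tree_extension
    by (rule measurable_compose[OF measurable_tree_extension])
qed

theorem theorem2p19:
  fixes d :: nat
    and a \<alpha> :: "nat \<Rightarrow> real"
    and N :: "nat \<Rightarrow> nat \<Rightarrow> nat"
    and M :: "nat \<Rightarrow> 'a measure"
    and \<xi> :: "nat \<Rightarrow> nat list \<Rightarrow> 'a \<Rightarrow> real"
    and P :: "'b measure"
  assumes "1 \<le> d"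
    and "\<And>j. j \<in> {1..d} \<Longrightarrow> a j > 0"
    and "\<And>j. j \<in> {1..d} \<Longrightarrow> \<alpha> j > 1"
    and "\<And>j. j \<in> {1..d} \<Longrightarrow> (\<lambda>n. real (N n j) / \<alpha> j ^ n) \<longlonglongrightarrow> 1"
    and "strict_mono_on {1..d} (grem_sigma a \<alpha>)"
    and "\<And>n. prob_space (M n)"
    and "\<And>n. prob_space.indep_vars (M n) (\<lambda>_. borel) (\<xi> n) (grem_nodes d N n)"
    and "\<And>n \<epsilon>. \<epsilon> \<in> grem_nodes d N n \<Longrightarrow> distributed (M n) lborel (\<xi> n \<epsilon>) std_normal_density"
    and "prob_space P"
  defines "E\<^sub>1 \<equiv> grem_E (grem_sigma a \<alpha> 1)"
  shows "converges_in_distribution (analytic_topology E\<^sub>1)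
           M (\<lambda>n \<omega>. \<lambda>\<beta>\<in>E\<^sub>1. grem_partition d a N n (\<xi> n) \<beta> \<omega> /
                (\<integral>\<omega>'. grem_partition d a N n (\<xi> n) \<beta> \<omega>' \<partial>M n))
           P (\<lambda>_. \<lambda>\<beta>\<in>E\<^sub>1. 1)"
proof -
  note a = assms(2) and \<alpha> = assms(3) and N = assms(4) and mono = assms(5) and M = assms(6)
  define s where "s = grem_sigma a \<alpha> 1"
  define W where "W n \<omega> \<beta> = level_weight \<beta> (\<lambda>i. sqrt (real n) * sqrt (a i)) N n d (\<lambda>\<delta>. \<xi> n \<delta> \<omega>)" for n \<omega> \<beta>
  have s: "s > 0"
    using a[of 1] \<alpha>[of 1] assms(1) by (simp add: s_def grem_sigma_def)
  \<comment> \<open>The first critical value is the smallest, so an exponent that works for level 1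
    works for all levels.\<close>
  have s_le: "s \<le> sqrt (2 * ln (\<alpha> i) / a i)" if "i \<in> {1..d}" for i
    using that strict_mono_on_leD[OF mono, of 1 i] assms(1) by (simp add: s_def grem_sigma_def)
  have tree: "gaussian_tree (M n) d N n (\<xi> n)" for n
    using assms(6-8) by (intro gaussian_tree.intro gaussian_tree_axioms.intro)
  have loc: "\<exists>r>0. uniform_limit_in_prob M W (\<lambda>_. 1) (ball z r)" if z: "z \<in> E\<^sub>1" for z
  proof -
    obtain p where p: "1 < p" "p \<le> 2" and pz: "p * (Re z)\<^sup>2 + p / (p - 1) * (Im z)\<^sup>2 < s\<^sup>2"
      using z s unfolding E\<^sub>1_def s_def[symmetric] by (elim grem_E_exponent)
    \<comment> \<open>With \<open>p\<close> fixed, \<open>h\<close> is continuous, so the strict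
      inequality at \<open>z\<close> persists with a margin \<delta> on a closed disc; hence the
      bound \<open>B\<close> below serves all \<open>u\<close> on the circle at once.\<close>
    define h where "h \<beta> = p * (Re \<beta>)\<^sup>2 + p / (p - 1) * (Im \<beta>)\<^sup>2" for \<beta>
    obtain \<delta> where \<delta>: "\<delta> > 0" "h z < s\<^sup>2 - \<delta>"
    proof
      have "h z < s\<^sup>2" using pz by (simp add: h_def)
      then show "(s\<^sup>2 - h z) / 2 > 0" "h z < s\<^sup>2 - (s\<^sup>2 - h z) / 2"
        by (simp_all add: field_simps)
    qed
    have "open {\<beta>. h \<beta> < s\<^sup>2 - \<delta>}"
      unfolding h_def by (intro open_Collect_less continuous_intros)
    then obtain r where r: "r > 0" "cball z r \<subseteq> {\<beta>. h \<beta> < s\<^sup>2 - \<delta>}"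
      using \<delta> unfolding open_contains_cball by blast
    define B where "B n = 48 * (\<Sum>m=1..d. \<Prod>i=1..m.
        (real (N n i) / \<alpha> i ^ n) powr (1 - p) * exp (- (a i * (p - 1) * \<delta> / 2)) ^ n)" for n
    have B0: "B \<longlonglongrightarrow> 48 * 0"
      unfolding B_def by (intro tendsto_mult tendsto_const level_factor_bound_tendsto_0 a p \<delta> N)
    \<comment> \<open>The moment bound needs nonempty levels, which the limit 1 of
      \<open>N n i / \<alpha> i ^ n\<close> ensures for large \<open>n\<close>.\<close>
    have "\<forall>\<^sub>F n in sequentially. N n i > 0" if "i \<in> {1..d}" for i
      using order_tendstoD(1)[OF N[OF that], of 0] by (auto elim!: eventually_mono intro: Nat.gr0I)
    then have Npos: "\<forall>\<^sub>F n in sequentially. \<forall>i\<in>{1..d}. N n i > 0"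
      by (simp add: eventually_ball_finite)
    have "uniform_limit_in_prob M W (\<lambda>_. 1) (ball z (r / 2))"
    proof (rule uniform_limit_in_prob_circle[OF M r(1)])
      show "W n \<omega> holomorphic_on cball z r" for n \<omega>
        unfolding W_def by (rule holomorphic_level_weight)
      show "(\<lambda>(\<omega>, t). W n \<omega> (circlepath z r t) - 1) \<in> borel_measurable (M n \<Otimes>\<^sub>M lborel)" for n
      proof -
        interpret gaussian_tree "M n" d N n "\<xi> n" by (rule tree)
        have "(\<lambda>(\<omega>, t). W n \<omega> (circlepath z r t)) \<in> borel_measurable (M n \<Otimes>\<^sub>M lborel)"
          unfolding W_def by (rule measurable_level_weight_path) (auto simp: circlepath intro!: continuous_intros)
        then show ?thesis by (simp add: case_prod_beta)
      qed
      fix e :: real assume e: "e > 0"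
      \<comment> \<open>Truncation at \<open>e / 2\<close> in
        \<open>nn_integral_norm_le_moment\<close>: half of \<open>e\<close> is the threshold and the
        other half must absorb the moment term.\<close>
      have "(\<lambda>n. (e / 2) powr (1 - p) * B n) \<longlonglongrightarrow> (e / 2) powr (1 - p) * (48 * 0)"
        by (intro tendsto_intros B0)
      then have "\<forall>\<^sub>F n in sequentially. (e / 2) powr (1 - p) * B n < e / 2"
        by (rule order_tendstoD(2)) (use e in simp)
      then show "\<forall>\<^sub>F n in sequentially. \<forall>u\<in>sphere z r.
          (\<integral>\<^sup>+\<omega>. ennreal (norm (W n \<omega> u - 1)) \<partial>M n) \<le> ennreal e"
        using Npos
      proof (rule eventually_elim2, intro ballI)
        fix n u assume n: "(e / 2) powr (1 - p) * B n < e / 2" "\<forall>i\<in>{1..d}. N n i > 0" and u: "u \<in> sphere z r"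
        interpret gaussian_tree "M n" d N n "\<xi> n" by (rule tree)
        have hu: "h u \<le> s\<^sup>2 - \<delta>" using u r(2) sphere_cball[of z r] by (auto simp: less_imp_le)
        have mom: "integrable (M n) (\<lambda>\<omega>. norm (W n \<omega> u - 1) powr p)"
          "expectation (\<lambda>\<omega>. norm (W n \<omega> u - 1) powr p)
            \<le> 48 * (\<Sum>m=1..d. \<Prod>i=1..m. real (N n i) powr (1 - p) * wick_moment p u (sqrt (real n) * sqrt (a i)))"
          using level_weight_moment_le[OF p, of d u "\<lambda>i. sqrt (real n) * sqrt (a i)"] n(2) unfolding W_def by auto
        note mom(2)
        also have "48 * (\<Sum>m=1..d. \<Prod>i=1..m. real (N n i) powr (1 - p) * wick_moment p u (sqrt (real n) * sqrt (a i))) \<le> B n"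
          unfolding B_def
        proof (intro mult_left_mono sum_mono prod_mono conjI)
          fix m i assume "m \<in> {1..d}" "i \<in> {1..m}"
          then have i: "i \<in> {1..d}" by auto
          show "real (N n i) powr (1 - p) * wick_moment p u (sqrt (real n) * sqrt (a i))
            \<le> (real (N n i) / \<alpha> i ^ n) powr (1 - p) * exp (- (a i * (p - 1) * \<delta> / 2)) ^ n"
            using level_factor_le[OF a[OF i] \<alpha>[OF i] less_imp_le[OF s] s_le[OF i] p(1) hu[unfolded h_def]] n(2) i
            by simp
        qed (auto simp: wick_moment_def)
        finally have EB: "expectation (\<lambda>\<omega>. norm (W n \<omega> u - 1) powr p) \<le> B n" .
        have "(\<lambda>\<omega>. W n \<omega> u) \<in> borel_measurable (M n)"
          unfolding W_def level_weight_tree_extension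
          by (rule measurable_compose[OF measurable_tree_extension borel_measurable_continuous_onI])
             (intro continuous_on_level_weight continuous_on_const continuous_on_product_coordinates)
        then have "(\<integral>\<^sup>+\<omega>. ennreal (norm (W n \<omega> u - 1)) \<partial>M n) \<le> ennreal (e / 2 + (e / 2) powr (1 - p) * B n)"
          using e p by (intro nn_integral_norm_le_moment mom EB) auto
        also have "\<dots> \<le> ennreal e" using n(1) by (intro ennreal_leI) simp
        finally show "(\<integral>\<^sup>+\<omega>. ennreal (norm (W n \<omega> u - 1)) \<partial>M n) \<le> ennreal e" .
      qed
    qed simp
    then show ?thesis using r(1) by (intro exI[of _ "r / 2"]) auto
  qed
  have W: "grem_partition d a N n (\<xi> n) \<beta> \<omega> / (\<integral>\<omega>'. grem_partition d a N n (\<xi> n) \<beta> \<omega>' \<partial>M n) = W n \<omega> \<beta>"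
    for n \<omega> \<beta>
    unfolding W_def by (rule gaussian_tree.grem_quotient_eq[OF tree])
  show ?thesis
    unfolding W
  proof (rule converges_in_distribution_analytic_const[OF M assms(9)])
    show "(\<lambda>\<omega>. \<lambda>\<beta>\<in>E\<^sub>1. W n \<omega> \<beta>) \<in> M n \<rightarrow>\<^sub>M borel_of_topology (analytic_topology E\<^sub>1)" for n
      unfolding W_def by (rule gaussian_tree.measurable_analytic_level_weight[OF tree])
    have "(\<lambda>\<beta>\<in>E\<^sub>1. 1) holomorphic_on E\<^sub>1"
      by (rule holomorphic_transform[of "\<lambda>_. 1"]) auto
    then show "(\<lambda>\<beta>\<in>E\<^sub>1. 1) \<in> analytic_fun E\<^sub>1" by (simp add: analytic_fun_def)
    fix K assume K: "compact K" "K \<subseteq> E\<^sub>1"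
    have "uniform_limit_in_prob M W (\<lambda>_. 1) K"
      by (rule uniform_limit_in_prob_compact[OF M _ K(1)]) (use loc K(2) in blast)
    then show "uniform_limit_in_prob M (\<lambda>n \<omega>. \<lambda>\<beta>\<in>E\<^sub>1. W n \<omega> \<beta>) (\<lambda>\<beta>\<in>E\<^sub>1. 1) K"
      by (rule uniform_limit_in_prob_cong) (use K(2) in auto)
  qed
qed

end
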